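(* Let $n\in\mathbb{N}$ and $b\in\mathbb{Q}^n\setminus\mathbb{Z}^n$. For any $k,\ell\in\mathbb{N}$ and any matrices $R\in\mathbb{R}^{n\times k}$, $P\in\mathbb{R}^{n\times\ell}$ define $$M(R,P):=\bigcap_{B \text{ maximal } (b+\mathbb{Z}^n)\text{-free set}} H_B(R,P),\qquad G(R,P):=\bigcap_{B\in\mathcal{G}_b}H_B(R,P).$$ Then there exists a constant $\alpha>0$ depending only on $n$ and $b$ such that $$M(R,P)\subseteq G(R,P)\subseteq \alpha\, M(R,P)$$ for all matrices $R,P$.
   Context: A $(b+\mathbb{Z}^n)$-free set is a closed convex set $B\subseteq\mathbb{R}^n$ with $0\in\operatorname{int}(B)$ and $\operatorname{int}(B)\cap(b+\mathbb{Z}^n)=\emptyset$. It is maximal if it is not strictly contained in another such set. The gauge function of such a $B$ is $\psi_B(x)=\inf\{\lambda>0: x/\lambda\in B\}$. For maximal $B$, the trivial lifting of $\psi_B$ is $\widetilde{\psi_B}(x)=\min(1,\inf_{z\in\mathbb{Z}^n}\psi_B(x+z))$. For $R$ with columns $r_1,\dots,r_k$ and $P$ with columns $p_1,\dots,p_\ell$, $$H_B(R,P):=\Big\{(s,y)\in\mathbb{R}^k_+\times\mathbb{R}^\ell_+ : \sum_{i=1}^k\psi_B(r_i)s_i+\sum_{i=1}^\ell\widetilde{\psi_B}(p_i)y_i\ge 1\Big\}.$$ For a set $M$ and $\alpha>0$, $\alpha M=\{\alpha x: x\in M\}$. Generalized cross-polytopes are defined recursively. In $\mathbb{R}^1$ they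 are the intervals $I_a=[a,a+1]$ with $a\in\mathbb{Z}$. For $d\ge2$, given a generalized cross-polytope $B'\subseteq\mathbb{R}^{d-1}$, a point $c\in B'$, $\gamma\in\mathbb{R}$ and $\mu\in(0,1)$, the generalized cross-polytope in $\mathbb{R}^d$ built out of $B',c,\gamma,\mu$ is the convex hull of $$\Big(\tfrac1\mu(B'-c)+c\Big)\times\{\gamma\}\quad\text{and}\quad \{c\}\times\Big(\tfrac1{1-\mu}(I_{\lfloor\gamma\rfloor}-\gamma)+\gamma\Big).$$ A generalized cross-polyhedron in $\mathbb{R}^n$ is a set of the form $U(X\times\mathbb{R}^{n-m})$, where $1\le m\le n$, $X\subseteq\mathbb{R}^m$ is a generalized cross-polytope in $\mathbb{R}^m$, and $U\in\mathbb{Z}^{n\times n}$ is unimodular ($\det U=\pm1$). $\mathcal{G}_b$ denotes the set of all $B=b+G$ where $G$ is a generalized cross-polyhedron in $\mathbb{R}^n$ with $-b\in\operatorname{int}(G)$ (each such $B$ is a maximal $(b+\mathbb{Z}^n)$-free set). *)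

theory Defs
  imports "HOL-Analysis.Analysis"
begin

definition int_lattice :: "(real ^ 'n) set" where
  "int_lattice = {z. \<forall>i. z $ i \<in> \<int>}"

definition lattice_free :: "real ^ 'n \<Rightarrow> (real ^ 'n) set \<Rightarrow> bool" where
  "lattice_free b B \<longleftrightarrow>
     closed B \<and> convex B \<and> 0 \<in> interior B \<and> interior B \<inter> (+) b ` int_lattice = {}"

definition maximal_lattice_free :: "real ^ 'n \<Rightarrow> (real ^ 'n) set \<Rightarrow> bool" where
  "maximal_lattice_free b B \<longleftrightarrow>
     lattice_free b B \<and> (\<nexists>B'. lattice_free b B' \<and> B \<subset> B')"

definition gauge :: "(real ^ 'n) set \<Rightarrow> real ^ 'n \<Rightarrow> real" where
  "gauge B x = Inf {t. t > 0 \<and> x /\<^sub>R t \<in> B}"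

definition trivial_lifting :: "(real ^ 'n) set \<Rightarrow> real ^ 'n \<Rightarrow> real" where
  "trivial_lifting B x = min 1 (INF z\<in>int_lattice. gauge B (x + z))"

text \<open>
  The numbers of columns \<open>k\<close> and \<open>l\<close> must range over all naturals for one and the same
  constant, so they cannot be type-level dimensions. A real matrix with \<open>n\<close> rows is given by
  the list of its columns, and a vector of length \<open>k\<close> by a list of length \<open>k\<close>.
\<close>

definition H :: "(real ^ 'n) set \<Rightarrow> (real ^ 'n) list \<Rightarrow> (real ^ 'n) list
    \<Rightarrow> (real list \<times> real list) set" where
  "H B R P = {(s, y). length s = length R \<and> length y = length P \<and>
     (\<forall>i<length R. s ! i \<ge> 0) \<and> (\<forall>i<length P. y ! i \<ge> 0) \<and>
     (\<Sum>i<length R. gauge B (R ! i) * s ! i)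
       + (\<Sum>i<length P. trivial_lifting B (P ! i) * y ! i) \<ge> 1}"

definition scale_set :: "real \<Rightarrow> (real list \<times> real list) set \<Rightarrow> (real list \<times> real list) set" where
  "scale_set \<alpha> M = (\<lambda>(s, y). (map ((*) \<alpha>) s, map ((*) \<alpha>) y)) ` M"

text \<open>
  The recursion defining generalized cross-polytopes changes the dimension, so \<open>\<real>\<^sup>d\<close>
  is realised as the coordinate subspace of \<open>\<real>\<^sup>n\<close> on a set \<open>S\<close> of \<open>d\<close> coordinates (all
  coordinates outside \<open>S\<close> vanish), and the point \<open>(x, t)\<close> of \<open>\<real>\<^sup>d\<^sup>-\<^sup>1 \<times> \<real>\<close> as
  \<open>x + axis i t\<close> with a new coordinate \<open>i\<close>. The coordinates may be introduced in any order; since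
  permutation matrices are unimodular, this does not affect the class of generalized
  cross-polyhedra below.
\<close>

inductive gen_cross_polytope :: "'n set \<Rightarrow> (real ^ 'n) set \<Rightarrow> bool" where
  base: "gen_cross_polytope {i} (axis i ` {of_int a .. of_int a + 1})" for a :: int
| step: "gen_cross_polytope (insert i S)
     (convex hull
       ((\<lambda>x. ((1 / \<mu>) *\<^sub>R (x - c) + c) + axis i \<gamma>) ` B' \<union>
        (\<lambda>t. c + axis i ((1 / (1 - \<mu>)) * (t - \<gamma>) + \<gamma>)) `
          {of_int \<lfloor>\<gamma>\<rfloor> .. of_int \<lfloor>\<gamma>\<rfloor> + 1}))"
  if "gen_cross_polytope S B'" "i \<notin> S" "c \<in> B'" "0 < \<mu>" "\<mu> < 1"

definition unimodular :: "real ^ 'n ^ 'n \<Rightarrow> bool" where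
  "unimodular U \<longleftrightarrow> (\<forall>i j. U $ i $ j \<in> \<int>) \<and> (det U = 1 \<or> det U = - 1)"

text \<open>
  With \<open>X\<close> in the coordinate subspace on \<open>S\<close>, the product of \<open>X\<close> with the space on the
  remaining coordinates is the set of all \<open>x + w\<close> with \<open>x\<close> in \<open>X\<close> and \<open>w\<close> vanishing on \<open>S\<close>.
  The condition \<open>1 \<le> card S \<le> n\<close> holds automatically.
\<close>

definition gen_cross_polyhedron :: "(real ^ 'n) set \<Rightarrow> bool" where
  "gen_cross_polyhedron G \<longleftrightarrow> (\<exists>S X U. gen_cross_polytope S X \<and> unimodular U \<and>
     G = (*v) U ` {x + w |x w. x \<in> X \<and> (\<forall>i\<in>S. w $ i = 0)})"

definition cross_family :: "real ^ 'n \<Rightarrow> (real ^ 'n) set set" where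
  "cross_family b = {(+) b ` G |G. gen_cross_polyhedron G \<and> - b \<in> interior G}"

definition M_closure :: "real ^ 'n \<Rightarrow> (real ^ 'n) list \<Rightarrow> (real ^ 'n) list
    \<Rightarrow> (real list \<times> real list) set" where
  "M_closure b R P = (\<Inter>B \<in> {B. maximal_lattice_free b B}. H B R P)"

definition G_closure :: "real ^ 'n \<Rightarrow> (real ^ 'n) list \<Rightarrow> (real ^ 'n) list
    \<Rightarrow> (real list \<times> real list) set" where
  "G_closure b R P = (\<Inter>B \<in> cross_family b. H B R P)"

end

theory Submission
  imports Defs
begin

text \<open>
  If \<open>\<alpha> B \<subseteq> C\<close>, then \<open>\<alpha> \<psi>\<^sub>C \<le> \<psi>\<^sub>B\<close>, also for the trivial liftings when \<open>\<alpha> \<le> 1\<close>. So the second inclusion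
  reduces to finding, for each lattice-free \<open>B\<close>, a member of \<open>cross_family b\<close> containing \<open>\<alpha> B\<close>; the
  first one only needs that the members of \<open>cross_family b\<close> are lattice-free, since by Zorn's lemma
  they then lie in maximal lattice-free sets.

  Put \<open>K = B / 2 - b\<close>, which misses \<open>\<int>\<^sup>n\<close>, and \<open>p = - b\<close>. By the flatness theorem and a unimodular
  change of coordinates, \<open>K\<close> is bounded in the direction of one coordinate \<open>i\<close>. If \<open>p\<^sub>i \<notin> \<int>\<close>, the distance
  from \<open>p\<^sub>i\<close> to \<open>\<int>\<close> is bounded below by the denominator of \<open>b\<close>, so \<open>K\<close>, shrunk towards \<open>p\<close>, lies in a split.
  If \<open>p\<^sub>i = 0\<close>, say, the slice \<open>x\<^sub>i = 0\<close> is treated by induction. The statement carried through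
  the induction is that the shrunken set lies in a simplex \<open>\<Delta>\<close> (times a linear space) that lies in a
  generalized cross-polyhedron \<open>G\<close>: the facet inequalities of \<open>\<Delta>\<close> on the slice extend to \<open>K\<close> with some
  slopes, and as \<open>\<Delta>\<close> is a simplex the extended inequalities meet in an apex \<open>q\<close>, for any slopes.
  After reflecting and relaxing the slopes, \<open>q\<close> has height in \<open>[-1, 0)\<close>. The integer translates of \<open>G\<close> cover the
  space, so an integer shear moves \<open>q\<close> over a point \<open>c\<close> of \<open>G\<close>, and the generalized cross-polyhedron built
  out of \<open>G\<close>, \<open>c\<close>, \<open>\<gamma> = 1/2\<close> and a suitable \<open>\<mu>\<close> coincides below height \<open>1/2\<close> with the cone from \<open>q\<close>
  over \<open>G\<close>.
\<close>

section \<open>Gauges and maximal lattice-free sets\<close>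

lemma zero_in_int_lattice: "0 \<in> int_lattice"
  by (simp add: int_lattice_def)

lemma int_lattice_add: "x \<in> int_lattice \<Longrightarrow> y \<in> int_lattice \<Longrightarrow> x + y \<in> int_lattice"
  by (simp add: int_lattice_def)

lemma int_lattice_diff: "x \<in> int_lattice \<Longrightarrow> y \<in> int_lattice \<Longrightarrow> x - y \<in> int_lattice"
  by (simp add: int_lattice_def)

lemma int_lattice_uminus: "x \<in> int_lattice \<Longrightarrow> - x \<in> int_lattice"
  by (simp add: int_lattice_def)

lemma int_lattice_scale: "r \<in> \<int> \<Longrightarrow> x \<in> int_lattice \<Longrightarrow> r *\<^sub>R x \<in> int_lattice"
  by (simp add: int_lattice_def)

lemma axis_in_int_lattice: "r \<in> \<int> \<Longrightarrow> axis i r \<in> int_lattice"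
  by (simp add: int_lattice_def axis_def)

text \<open>Guarantees that the infimum defining \<open>gauge\<close> is over a nonempty set; on an
  empty set \<open>Inf\<close> would carry no information.\<close>

lemma gauge_set_nonempty:
  fixes B :: "(real ^ 'n) set"
  assumes "0 \<in> interior B"
  shows "\<exists>t>0. x /\<^sub>R t \<in> B"
proof -
  obtain e where e: "e > 0" "ball 0 e \<subseteq> B"
    using assms mem_interior by blast
  have "0 < 1 + norm x" by (rule add_pos_nonneg) auto
  then have "norm (x /\<^sub>R ((norm x + 1) / e)) < e"
    using e by (simp add: divide_simps)
  then have "x /\<^sub>R ((norm x + 1) / e) \<in> B"
    using e(2) by (auto simp: subset_iff)
  moreover have "(norm x + 1) / e > 0"
    using e(1) by (smt (verit) norm_ge_zero divide_pos_pos)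
  ultimately show ?thesis by blast
qed

lemma gauge_nonneg:
  assumes "0 \<in> interior B"
  shows "0 \<le> gauge B x"
  unfolding gauge_def using gauge_set_nonempty[OF assms, of x] by (intro cInf_greatest) auto

text \<open>An admissible scale \<open>t\<close> for \<open>B\<close> yields the admissible scale
  \<open>t / a\<close> for \<open>C\<close>, so the infima compare with factor
  \<open>a\<close>.\<close>

lemma gauge_scaled_le:
  assumes B: "0 \<in> interior B" and "0 < a" and sub: "\<And>x. x \<in> B \<Longrightarrow> a *\<^sub>R x \<in> C"
  shows "a * gauge C x \<le> gauge B x"
  unfolding gauge_def[of B]
proof (rule cInf_greatest)
  show "{t. 0 < t \<and> x /\<^sub>R t \<in> B} \<noteq> {}"
    using gauge_set_nonempty[OF B, of x] by auto
next
  fix t assume "t \<in> {t. 0 < t \<and> x /\<^sub>R t \<in> B}"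
  then have t: "0 < t" "x /\<^sub>R t \<in> B" by auto
  have "a *\<^sub>R (x /\<^sub>R t) = x /\<^sub>R (t / a)"
    using t \<open>0 < a\<close> by (simp add: field_simps)
  then have "t / a \<in> {t. 0 < t \<and> x /\<^sub>R t \<in> C}"
    using sub[OF t(2)] t(1) \<open>0 < a\<close> by auto
  moreover have "bdd_below {t. 0 < t \<and> x /\<^sub>R t \<in> C}"
    by (rule bdd_belowI[of _ 0]) auto
  ultimately have "gauge C x \<le> t / a"
    unfolding gauge_def by (rule cInf_lower)
  then show "a * gauge C x \<le> t"
    using \<open>0 < a\<close> by (simp add: field_simps)
qed

text \<open>The bound \<open>a \<le> 1\<close> makes the truncation at 1 compatible with scaling:
  \<open>a * min 1 m\<close> equals \<open>min a (a * m)\<close>, and both entries only grow on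
  passing to \<open>B\<close>.\<close>

lemma trivial_lifting_scaled_le:
  assumes B: "0 \<in> interior B" and C: "0 \<in> interior C" and "0 < a" "a \<le> 1"
    and sub: "\<And>x. x \<in> B \<Longrightarrow> a *\<^sub>R x \<in> C"
  shows "a * trivial_lifting C x \<le> trivial_lifting B x"
proof -
  have ne: "int_lattice \<noteq> {}" using zero_in_int_lattice by blast
  have "a * (INF z\<in>int_lattice. gauge C (x + z)) \<le> gauge B (x + z)" if z: "z \<in> int_lattice" for z
  proof -
    have "bdd_below ((\<lambda>z. gauge C (x + z)) ` int_lattice)"
      using gauge_nonneg[OF C] by (intro bdd_belowI[of _ 0]) auto
    then have "(INF z\<in>int_lattice. gauge C (x + z)) \<le> gauge C (x + z)"
      using z by (rule cINF_lower)
    then have "a * (INF z\<in>int_lattice. gauge C (x + z)) \<le> a * gauge C (x + z)"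
      using \<open>0 < a\<close> by simp
    also have "\<dots> \<le> gauge B (x + z)"
      by (rule gauge_scaled_le[OF B \<open>0 < a\<close> sub])
    finally show ?thesis .
  qed
  then have le: "a * (INF z\<in>int_lattice. gauge C (x + z)) \<le> (INF z\<in>int_lattice. gauge B (x + z))"
    using ne by (intro cINF_greatest) auto
  have "a * trivial_lifting C x = min a (a * (INF z\<in>int_lattice. gauge C (x + z)))"
    unfolding trivial_lifting_def using \<open>0 < a\<close> by (simp add: min_mult_distrib_left)
  also have "\<dots> \<le> trivial_lifting B x"
    unfolding trivial_lifting_def by (intro min.mono le \<open>a \<le> 1\<close>)
  finally show ?thesis .
qed

text \<open>Dividing the variables by \<open>a\<close> compensates for the factor \<open>a\<close>
  in the comparison of coefficients; \<open>a = 1\<close> gives monotonicity in the set.\<close>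

lemma H_scaled_subset:
  assumes B: "0 \<in> interior B" and C: "0 \<in> interior C" and a: "0 < a" "a \<le> 1"
    and sub: "\<And>x. x \<in> B \<Longrightarrow> a *\<^sub>R x \<in> C"
    and mem: "(s, y) \<in> H C R P"
  shows "(map ((*) (1 / a)) s, map ((*) (1 / a)) y) \<in> H B R P"
proof -
  have len: "length s = length R" "length y = length P"
    and pos: "\<And>i. i < length R \<Longrightarrow> s ! i \<ge> 0" "\<And>i. i < length P \<Longrightarrow> y ! i \<ge> 0"
    and ge: "1 \<le> (\<Sum>i<length R. gauge C (R ! i) * s ! i)
        + (\<Sum>i<length P. trivial_lifting C (P ! i) * y ! i)"
    using mem by (auto simp: H_def)
  have "gauge C (R ! i) * s ! i \<le> gauge B (R ! i) * (map ((*) (1 / a)) s ! i)"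
    if "i < length R" for i
    using mult_right_mono[OF gauge_scaled_le[OF B a(1) sub], of "s ! i / a" "R ! i"] pos(1)[OF that] that len a
    by (simp add: field_simps)
  moreover have "trivial_lifting C (P ! i) * y ! i \<le> trivial_lifting B (P ! i) * (map ((*) (1 / a)) y ! i)"
    if "i < length P" for i
    using mult_right_mono[OF trivial_lifting_scaled_le[OF B C a sub], of "y ! i / a" "P ! i"] pos(2)[OF that] that len a
    by (simp add: field_simps)
  ultimately have "1 \<le> (\<Sum>i<length R. gauge B (R ! i) * (map ((*) (1 / a)) s ! i))
        + (\<Sum>i<length P. trivial_lifting B (P ! i) * (map ((*) (1 / a)) y ! i))"
    by (intro order_trans[OF ge] add_mono sum_mono) auto
  then show ?thesis
    using len pos a by (auto simp: H_def)
qed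

corollary H_mono:
  assumes "0 \<in> interior B" "B \<subseteq> C"
  shows "H C R P \<subseteq> H B R P"
proof clarify
  fix s y assume "(s, y) \<in> H C R P"
  moreover have "0 \<in> interior C" using assms interior_mono by blast
  ultimately have "(map ((*) (1 / 1)) s, map ((*) (1 / 1)) y) \<in> H B R P"
    using assms by (intro H_scaled_subset[of B C 1]) auto
  then show "(s, y) \<in> H B R P" by (simp add: map_idI)
qed

text \<open>Every member of a chain has \<open>0\<close> in its interior, so an interior point of the union lies in the
  interior of a single member: push it slightly outwards and use that convex sets shrink into their
  interior.\<close>

lemma lattice_free_chain_bound:
  assumes "\<C> \<noteq> {}" and chain: "subset.chain {B. lattice_free b B} \<C>"
  shows "\<exists>U. lattice_free b U \<and> (\<forall>B\<in>\<C>. B \<subseteq> U)"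
proof (intro exI conjI ballI)
  let ?U = "closure (\<Union>\<C>)"
  have mem: "lattice_free b B" if "B \<in> \<C>" for B
    using chain that by (auto simp: subset_chain_def)
  have lin: "A \<subseteq> B \<or> B \<subseteq> A" if "A \<in> \<C>" "B \<in> \<C>" for A B
    using chain that by (auto simp: subset_chain_def)
  have conv: "convex (\<Union>\<C>)"
  proof (rule convexI)
    fix x y and u v :: real
    assume x: "x \<in> \<Union>\<C>" and y: "y \<in> \<Union>\<C>" and uv: "0 \<le> u" "0 \<le> v" "u + v = 1"
    obtain A B where AB: "A \<in> \<C>" "x \<in> A" "B \<in> \<C>" "y \<in> B" using x y by blast
    obtain D where D: "D \<in> \<C>" "x \<in> D" "y \<in> D" using lin[OF AB(1) AB(3)] AB by blast
    then have "convex D" using mem by (auto simp: lattice_free_def)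
    then show "u *\<^sub>R x + v *\<^sub>R y \<in> \<Union>\<C>" using D uv by (auto dest: convexD)
  qed
  show "lattice_free b ?U"
    unfolding lattice_free_def
  proof (intro conjI)
    show "closed ?U" by simp
    show "convex ?U" using conv by (rule convex_closure)
    have int: "interior ?U = interior (\<Union>\<C>)"
      by (rule convex_interior_closure[OF conv])
    obtain B where "B \<in> \<C>" using \<open>\<C> \<noteq> {}\<close> by blast
    then have "0 \<in> interior (\<Union>\<C>)"
      using mem[of B] interior_mono[of B "\<Union>\<C>"] by (auto simp: lattice_free_def)
    then show "0 \<in> interior ?U" by (simp add: int)
    have "\<exists>B\<in>\<C>. x \<in> interior B" if "x \<in> interior (\<Union>\<C>)" for x
    proof -
      have "isCont (\<lambda>r. r *\<^sub>R x) 1" by simp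
      then have "((\<lambda>r. r *\<^sub>R x) \<longlongrightarrow> 1 *\<^sub>R x) (at 1)" by (simp add: isCont_def)
      then have "eventually (\<lambda>r. r *\<^sub>R x \<in> interior (\<Union>\<C>)) (at 1)"
        using that by (intro topological_tendstoD) auto
      then obtain d where d: "d > 0" "\<And>r. r \<noteq> 1 \<Longrightarrow> dist r 1 < d \<Longrightarrow> r *\<^sub>R x \<in> interior (\<Union>\<C>)"
        unfolding eventually_at by blast
      define r where "r = 1 + d / 2"
      have r: "r > 1" using d(1) by (simp add: r_def)
      have "r *\<^sub>R x \<in> interior (\<Union>\<C>)"
        using d(1) by (intro d(2)) (simp_all add: r_def dist_real_def)
      then have "r *\<^sub>R x \<in> \<Union>\<C>"
        using interior_subset by (rule rev_subsetD)
      then obtain B where B: "B \<in> \<C>" "r *\<^sub>R x \<in> B" by blast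
      have "r *\<^sub>R x - (1 - 1 / r) *\<^sub>R (r *\<^sub>R x - 0) \<in> interior B"
        using mem[OF B(1)] B(2) r
        by (intro mem_interior_convex_shrink) (simp_all add: lattice_free_def)
      moreover have "r *\<^sub>R x - (1 - 1 / r) *\<^sub>R (r *\<^sub>R x - 0) = x"
        using r by (simp add: algebra_simps)
      ultimately have "x \<in> interior B" by simp
      then show ?thesis using B(1) by (rule bexI)
    qed
    moreover have "interior B \<inter> (+) b ` int_lattice = {}" if "B \<in> \<C>" for B
      using mem[OF that] by (simp add: lattice_free_def)
    ultimately show "interior ?U \<inter> (+) b ` int_lattice = {}"
      unfolding int disjoint_iff by blast
  qed
next
  fix B assume "B \<in> \<C>"
  then show "B \<subseteq> closure (\<Union>\<C>)" by (rule order_trans[OF Union_upper closure_subset])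
qed

lemma lattice_free_imp_subset_maximal:
  assumes "lattice_free b B"
  shows "\<exists>C. maximal_lattice_free b C \<and> B \<subseteq> C"
proof -
  let ?A = "{C. lattice_free b C \<and> B \<subseteq> C}"
  have "\<exists>M\<in>?A. \<forall>X\<in>?A. M \<subseteq> X \<longrightarrow> X = M"
  proof (rule subset_Zorn)
    fix \<C> assume chain: "subset.chain ?A \<C>"
    show "\<exists>U\<in>?A. \<forall>X\<in>\<C>. X \<subseteq> U"
    proof (cases "\<C> = {}")
      case True
      then show ?thesis using assms by blast
    next
      case False
      have "subset.chain {B. lattice_free b B} \<C>"
        using chain by (auto simp: subset_chain_def)
      from lattice_free_chain_bound[OF False this] obtain U
        where U: "lattice_free b U" "\<forall>X\<in>\<C>. X \<subseteq> U" by blast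
      moreover have "B \<subseteq> U"
        using U(2) False chain by (auto simp: subset_chain_def)
      ultimately show ?thesis by blast
    qed
  qed
  then obtain M where M: "M \<in> ?A" and max: "\<forall>X\<in>?A. M \<subseteq> X \<longrightarrow> X = M" ..
  have "maximal_lattice_free b M"
    unfolding maximal_lattice_free_def
  proof (intro conjI notI)
    show "lattice_free b M" using M by simp
    assume "\<exists>X. lattice_free b X \<and> M \<subset> X"
    then obtain X where "lattice_free b X" "M \<subset> X" by blast
    moreover from this have "X \<in> ?A" using M by auto
    ultimately show False using max by auto
  qed
  then show ?thesis using M by auto
qed

section \<open>Generalized cross-polytopes\<close>

definition coord_space :: "'n set \<Rightarrow> (real ^ 'n) set" where
  "coord_space S = {x. \<forall>j. j \<notin> S \<longrightarrow> x $ j = 0}"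

lemma subspace_coord_space: "subspace (coord_space S)"
  by (auto simp: subspace_def coord_space_def)

lemma coord_space_add: "x \<in> coord_space S \<Longrightarrow> y \<in> coord_space S \<Longrightarrow> x + y \<in> coord_space S"
  and coord_space_diff: "x \<in> coord_space S \<Longrightarrow> y \<in> coord_space S \<Longrightarrow> x - y \<in> coord_space S"
  and coord_space_uminus: "x \<in> coord_space S \<Longrightarrow> - x \<in> coord_space S"
  and coord_space_scale: "x \<in> coord_space S \<Longrightarrow> r *\<^sub>R x \<in> coord_space S"
  and zero_in_coord_space: "0 \<in> coord_space S"
  and coord_space_mono: "S \<subseteq> T \<Longrightarrow> coord_space S \<subseteq> coord_space T"
  and coord_space_nth: "x \<in> coord_space S \<Longrightarrow> j \<notin> S \<Longrightarrow> x $ j = 0"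
  by (auto simp: coord_space_def)

lemma coord_space_UNIV: "coord_space UNIV = UNIV"
  by (simp add: coord_space_def)

lemma coord_space_empty: "coord_space {} = {0}"
  by (auto simp: coord_space_def vec_eq_iff)

lemma axis_in_coord_space: "i \<in> S \<Longrightarrow> axis i r \<in> coord_space S"
  by (auto simp: coord_space_def axis_def)

lemmas coord_space_intros = coord_space_add coord_space_diff coord_space_uminus coord_space_scale
  zero_in_coord_space axis_in_coord_space

lemma coord_space_minus_axis:
  assumes "x \<in> coord_space (insert i S)"
  shows "x - axis i (x $ i) \<in> coord_space S"
  using assms by (auto simp: coord_space_def axis_def)

lemma closed_coord_space: "closed (coord_space S)"
  by (intro closed_subspace subspace_coord_space)

lemma axis_eq_scaleR: "axis i r = r *\<^sub>R axis i (1::real)"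
  by (simp add: vec_eq_iff axis_def)

lemma continuous_on_axis [continuous_intros]:
  "continuous_on A f \<Longrightarrow> continuous_on A (\<lambda>x. axis i (f x :: real))"
  by (subst axis_eq_scaleR) (intro continuous_intros)

lemma gen_cross_polytope_subset:
  "gen_cross_polytope S X \<Longrightarrow> X \<subseteq> coord_space S"
proof (induction rule: gen_cross_polytope.induct)
  case (base a i)
  then show ?case by (auto intro: axis_in_coord_space)
next
  case (step S B' i c \<mu> \<gamma>)
  have "coord_space S \<subseteq> coord_space (insert i S)"
    by (intro coord_space_mono) auto
  with step have "B' \<subseteq> coord_space (insert i S)" by blast
  then show ?case
    using \<open>c \<in> B'\<close>
    by (intro hull_minimal subspace_imp_convex subspace_coord_space)
       (auto intro!: coord_space_intros)
qed

lemma gen_cross_polytope_convex: "gen_cross_polytope S X \<Longrightarrow> convex X"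
proof (induction rule: gen_cross_polytope.induct)
  case (base a i)
  have "axis i ` {of_int a .. of_int a + 1 :: real} = (\<lambda>t. t *\<^sub>R axis i 1) ` {of_int a .. of_int a + 1::real}"
    by (intro image_cong refl axis_eq_scaleR)
  then show ?case
    by (simp add: convex_linear_image linear_scaleR_left)
qed (rule convex_convex_hull)

lemma gen_cross_polytope_compact: "gen_cross_polytope S X \<Longrightarrow> compact X"
proof (induction rule: gen_cross_polytope.induct)
  case (base a i)
  show ?case
    by (intro compact_continuous_image continuous_intros) auto
next
  case (step S B' i c \<mu> \<gamma>)
  show ?case
    by (intro compact_convex_hull compact_Un compact_continuous_image continuous_intros step.IH) auto
qed

text \<open>The slope \<open>\<beta>\<close> tilts the functional \<open>a\<close> along the new coordinate; the two conditions say that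
  the tilted functional is maximal at \<open>z\<close> over the two pieces spanning the new polytope.\<close>

lemma tilted_functional_bound:
  fixes a z c :: "real ^ 'n"
  assumes B: "B \<subseteq> coord_space S" and "i \<notin> S" "c \<in> B" and \<mu>: "0 < \<mu>" "\<mu> < 1"
    and a: "a \<in> coord_space S" "\<And>x. x \<in> B \<Longrightarrow> a \<bullet> x \<le> a \<bullet> z"
    and 1: "(a \<bullet> z - a \<bullet> c) * (1 - \<mu>) / \<mu> \<le> \<beta> * (z $ i - \<gamma>)"
    and 2: "\<And>t. of_int \<lfloor>\<gamma>\<rfloor> \<le> t \<Longrightarrow> t \<le> of_int \<lfloor>\<gamma>\<rfloor> + 1 \<Longrightarrow>
       \<beta> * ((t - \<gamma>) / (1 - \<mu>) - (z $ i - \<gamma>)) \<le> a \<bullet> z - a \<bullet> c"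
    and x: "x \<in> convex hull
       ((\<lambda>x. ((1 / \<mu>) *\<^sub>R (x - c) + c) + axis i \<gamma>) ` B \<union>
        (\<lambda>t. c + axis i ((1 / (1 - \<mu>)) * (t - \<gamma>) + \<gamma>)) ` {of_int \<lfloor>\<gamma>\<rfloor> .. of_int \<lfloor>\<gamma>\<rfloor> + 1})"
  shows "(a + axis i \<beta>) \<bullet> x \<le> (a + axis i \<beta>) \<bullet> z"
proof -
  let ?H = "{x. (a + axis i \<beta>) \<bullet> x \<le> (a + axis i \<beta>) \<bullet> z}"
  have ai: "a $ i = 0" and Bi: "\<And>x. x \<in> B \<Longrightarrow> x $ i = 0"
    using a(1) B \<open>i \<notin> S\<close> by (auto simp: coord_space_def)
  have ci: "c $ i = 0" using Bi \<open>c \<in> B\<close> by blast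
  have eval: "(a + axis i \<beta>) \<bullet> (y + axis i t) = a \<bullet> y + \<beta> * t" if "y $ i = 0" for y t
    using that ai by (simp add: inner_add_left inner_add_right inner_axis inner_axis')
  have evalz: "(a + axis i \<beta>) \<bullet> z = a \<bullet> z + \<beta> * z $ i"
    by (simp add: inner_add_left inner_axis')
  have gen1: "((1 / \<mu>) *\<^sub>R (x - c) + c) + axis i \<gamma> \<in> ?H" if "x \<in> B" for x
  proof -
    have "a \<bullet> ((1 / \<mu>) *\<^sub>R (x - c) + c) = (a \<bullet> x - a \<bullet> c) / \<mu> + a \<bullet> c"
      by (simp add: inner_add_right inner_diff_right)
    also have "\<dots> \<le> (a \<bullet> z - a \<bullet> c) / \<mu> + a \<bullet> c"
      using a(2)[OF that] \<mu> by (simp add: divide_right_mono)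
    also have "\<dots> = a \<bullet> z + (a \<bullet> z - a \<bullet> c) * (1 - \<mu>) / \<mu>"
      using \<mu> by (simp add: field_simps)
    also have "\<dots> \<le> a \<bullet> z + \<beta> * (z $ i - \<gamma>)" using 1 by simp
    finally have "a \<bullet> ((1 / \<mu>) *\<^sub>R (x - c) + c) + \<beta> * \<gamma> \<le> a \<bullet> z + \<beta> * z $ i"
      by (simp add: right_diff_distrib)
    moreover have "((1 / \<mu>) *\<^sub>R (x - c) + c) $ i = 0"
      using Bi[OF that] ci by simp
    ultimately show ?thesis
      unfolding mem_Collect_eq evalz by (subst eval)
  qed
  have gen2: "c + axis i ((1 / (1 - \<mu>)) * (t - \<gamma>) + \<gamma>) \<in> ?H"
    if "t \<in> {of_int \<lfloor>\<gamma>\<rfloor> .. of_int \<lfloor>\<gamma>\<rfloor> + 1}" for t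
    using 2[of t] that unfolding mem_Collect_eq evalz eval[OF ci] by (simp add: algebra_simps)
  have "convex hull
       ((\<lambda>x. ((1 / \<mu>) *\<^sub>R (x - c) + c) + axis i \<gamma>) ` B \<union>
        (\<lambda>t. c + axis i ((1 / (1 - \<mu>)) * (t - \<gamma>) + \<gamma>)) ` {of_int \<lfloor>\<gamma>\<rfloor> .. of_int \<lfloor>\<gamma>\<rfloor> + 1}) \<subseteq> ?H"
    using gen1 gen2 by (intro hull_minimal convex_halfspace_le) auto
  then show ?thesis using x by auto
qed

text \<open>Lattice-freeness in separating form, suited to the recursion: a functional for the
  smaller polytope ignores the new coordinate, so it can be taken for the same \<open>z\<close> and
  only has to be tilted along \<open>i\<close>.\<close>

lemma gen_cross_polytope_separated:
  assumes "gen_cross_polytope S X" "z \<in> int_lattice"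
  shows "\<exists>a\<in>coord_space S. a \<noteq> 0 \<and> (\<forall>x\<in>X. a \<bullet> x \<le> a \<bullet> z)"
  using assms
proof (induction rule: gen_cross_polytope.induct)
  case (base a i)
  have "z $ i \<in> \<int>" using base by (simp add: int_lattice_def)
  then obtain k :: int where k: "z $ i = of_int k" by (auto elim: Ints_cases)
  show ?case
  proof (cases "k \<le> a")
    case True
    then show ?thesis
      using k by (intro bexI[of _ "axis i (- 1)"]) (auto simp: inner_axis' axis_eq_0_iff intro: axis_in_coord_space)
  next
    case False
    then have "of_int a + 1 \<le> (of_int k :: real)" by linarith
    then show ?thesis
      using k by (intro bexI[of _ "axis i 1"]) (auto simp: inner_axis' axis_eq_0_iff intro: axis_in_coord_space)
  qed
next
  case (step S B i c \<mu> \<gamma>)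
  obtain a where a: "a \<in> coord_space S" "a \<noteq> 0" "\<And>x. x \<in> B \<Longrightarrow> a \<bullet> x \<le> a \<bullet> z"
    using step.IH[OF step.prems] by blast
  have B: "B \<subseteq> coord_space S" using step by (intro gen_cross_polytope_subset)
  note bound = tilted_functional_bound[OF B step.hyps(2-5) a(1) a(3)]
  have ai: "a $ i = 0" using a(1) \<open>i \<notin> S\<close> by (rule coord_space_nth)
  have mem: "a + axis i \<beta> \<in> coord_space (insert i S)" for \<beta>
    using a(1) coord_space_mono[of S "insert i S"] by (auto intro!: coord_space_intros)
  have nz: "a + axis i \<beta> \<noteq> 0" for \<beta>
  proof
    obtain j where j: "a $ j \<noteq> 0" using a(2) by (auto simp: vec_eq_iff)
    then have "j \<noteq> i" using ai by auto
    assume "a + axis i \<beta> = 0"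
    then have "(a + axis i \<beta>) $ j = 0" by simp
    then show False using j \<open>j \<noteq> i\<close> by (simp add: axis_def)
  qed
  define D where "D = a \<bullet> z - a \<bullet> c"
  have D: "D \<ge> 0" using a(3)[OF \<open>c \<in> B\<close>] by (simp add: D_def)
  have "z $ i \<in> \<int>" using step.prems by (simp add: int_lattice_def)
  then obtain k :: int where k: "z $ i = of_int k" by (auto elim: Ints_cases)
  note \<mu> = \<open>0 < \<mu>\<close> \<open>\<mu> < 1\<close>
  let ?f = "of_int \<lfloor>\<gamma>\<rfloor> :: real"
  \<comment> \<open>The cases record on which side of the unit interval \<open>z\<close> lies. An
    integral \<open>\<gamma>\<close> is the lower end of its interval, and the downward slope
    formula would then divide by zero.\<close>
  consider (up) "?f + 1 \<le> z $ i" | (down) "z $ i \<le> ?f" "?f < \<gamma>" | (int) "z $ i \<le> ?f" "\<gamma> = ?f"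
  proof -
    have "of_int (\<lfloor>\<gamma>\<rfloor> + 1) \<le> (of_int k :: real) \<or> of_int k \<le> ?f"
      unfolding of_int_le_iff by linarith
    then have "?f + 1 \<le> of_int k \<or> of_int k \<le> ?f" by simp
    moreover have "?f < \<gamma> \<or> \<gamma> = ?f" by linarith
    ultimately show ?thesis using that unfolding k by metis
  qed
  then show ?case
  proof cases
    case up
    define g where "g = ?f + 1 - \<gamma>"
    have g: "g > 0" unfolding g_def by linarith
    \<comment> \<open>This slope gives equality in the first condition when \<open>z\<close> is at
      the upper end of the interval; the second condition is then tight at that end too.\<close>
    define \<beta> where "\<beta> = D * (1 - \<mu>) / (\<mu> * g)"
    have \<beta>: "\<beta> \<ge> 0" using D \<mu> g by (simp add: \<beta>_def)
    have \<beta>g: "\<beta> * g = D * (1 - \<mu>) / \<mu>" using g \<mu> by (simp add: \<beta>_def)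
    have "\<beta> * g \<le> \<beta> * (z $ i - \<gamma>)" using up \<beta> by (intro mult_left_mono) (auto simp: g_def)
    then have 1: "(a \<bullet> z - a \<bullet> c) * (1 - \<mu>) / \<mu> \<le> \<beta> * (z $ i - \<gamma>)"
      using \<beta>g by (simp add: D_def)
    have 2: "\<beta> * ((t - \<gamma>) / (1 - \<mu>) - (z $ i - \<gamma>)) \<le> a \<bullet> z - a \<bullet> c" if "?f \<le> t" "t \<le> ?f + 1" for t
    proof -
      have "(t - \<gamma>) / (1 - \<mu>) \<le> g / (1 - \<mu>)"
        using that \<mu> by (intro divide_right_mono) (auto simp: g_def)
      then have "\<beta> * ((t - \<gamma>) / (1 - \<mu>) - (z $ i - \<gamma>)) \<le> \<beta> * (g / (1 - \<mu>) - g)"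
        using up \<beta> by (intro mult_left_mono) (auto simp: g_def)
      also have "\<dots> = (\<beta> * g) * (\<mu> / (1 - \<mu>))" using \<mu> by (simp add: field_simps)
      also have "\<dots> = D" unfolding \<beta>g using \<mu> by simp
      finally show ?thesis by (simp add: D_def)
    qed
    show ?thesis
      by (intro bexI[of _ "a + axis i \<beta>"] conjI ballI nz mem) (rule bound, assumption, rule 1, rule 2, assumption+)
  next
    case down
    define g where "g = \<gamma> - ?f"
    have g: "g > 0" using down by (simp add: g_def)
    define \<beta> where "\<beta> = D * (1 - \<mu>) / (\<mu> * g)"
    have \<beta>: "\<beta> \<ge> 0" using D \<mu> g by (simp add: \<beta>_def)
    have \<beta>g: "\<beta> * g = D * (1 - \<mu>) / \<mu>" using g \<mu> by (simp add: \<beta>_def)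
    have "\<beta> * g \<le> \<beta> * (\<gamma> - z $ i)" using down \<beta> by (intro mult_left_mono) (auto simp: g_def)
    then have 1: "(a \<bullet> z - a \<bullet> c) * (1 - \<mu>) / \<mu> \<le> (- \<beta>) * (z $ i - \<gamma>)"
      using \<beta>g by (simp add: D_def algebra_simps)
    have 2: "(- \<beta>) * ((t - \<gamma>) / (1 - \<mu>) - (z $ i - \<gamma>)) \<le> a \<bullet> z - a \<bullet> c" if "?f \<le> t" "t \<le> ?f + 1" for t
    proof -
      have "(\<gamma> - t) / (1 - \<mu>) \<le> g / (1 - \<mu>)"
        using that \<mu> by (intro divide_right_mono) (auto simp: g_def)
      then have "\<beta> * ((\<gamma> - t) / (1 - \<mu>) - (\<gamma> - z $ i)) \<le> \<beta> * (g / (1 - \<mu>) - g)"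
        using down \<beta> by (intro mult_left_mono) (auto simp: g_def)
      also have "\<dots> = (\<beta> * g) * (\<mu> / (1 - \<mu>))" using \<mu> by (simp add: field_simps)
      also have "\<dots> = D" unfolding \<beta>g using \<mu> by simp
      finally have "\<beta> * ((\<gamma> - t) / (1 - \<mu>) - (\<gamma> - z $ i)) \<le> D" .
      moreover have "(- \<beta>) * ((t - \<gamma>) / (1 - \<mu>) - (z $ i - \<gamma>))
          = \<beta> * ((\<gamma> - t) / (1 - \<mu>) - (\<gamma> - z $ i))"
        using \<mu> by (simp add: field_simps)
      ultimately show ?thesis by (simp add: D_def)
    qed
    show ?thesis
      by (intro bexI[of _ "a + axis i (- \<beta>)"] conjI ballI nz mem) (rule bound, assumption, rule 1, rule 2, assumption+)
  next
    case int
    \<comment> \<open>Here the polytope has no points below height \<open>\<gamma>\<close>, so the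
      hyperplane at this height separates: the tilting lemma with zero functional.\<close>
    have "(0 + axis i (- 1)) \<bullet> x \<le> (0 + axis i (- 1)) \<bullet> z"
      if "x \<in> convex hull
       ((\<lambda>x. ((1 / \<mu>) *\<^sub>R (x - c) + c) + axis i \<gamma>) ` B \<union>
        (\<lambda>t. c + axis i ((1 / (1 - \<mu>)) * (t - \<gamma>) + \<gamma>)) ` {?f .. ?f + 1})" for x
    proof (rule tilted_functional_bound[OF B step.hyps(2-5) zero_in_coord_space _ _ _ that])
      fix t assume "?f \<le> t"
      then have "0 \<le> (t - \<gamma>) / (1 - \<mu>)" using int \<mu> by simp
      then show "- 1 * ((t - \<gamma>) / (1 - \<mu>) - (z $ i - \<gamma>)) \<le> 0 \<bullet> z - 0 \<bullet> c"
        using int by simp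
    qed (use int in auto)
    moreover have "axis i (- 1) \<in> coord_space (insert i S)" by (simp add: axis_in_coord_space)
    moreover have "axis i (- 1 :: real) \<noteq> 0" by (simp add: axis_eq_0_iff)
    ultimately show ?thesis
      by (intro bexI[of _ "axis i (- 1)"]) auto
  qed
qed

text \<open>At each step the new polytope contains the product of the smaller one with a unit
  interval, whose lattice translates cover by induction.\<close>

lemma gen_cross_polytope_covering:
  assumes "gen_cross_polytope S X" "v \<in> coord_space S"
  shows "\<exists>z\<in>int_lattice \<inter> coord_space S. v - z \<in> X"
  using assms
proof (induction arbitrary: v rule: gen_cross_polytope.induct)
  case (base a i)
  have v: "v = axis i (v $ i)"
    using base by (auto simp: coord_space_def vec_eq_iff axis_def)
  let ?z = "axis i (of_int (\<lfloor>v $ i\<rfloor> - a)) :: real ^ 'a"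
  have "v - ?z = axis i (v $ i - of_int (\<lfloor>v $ i\<rfloor> - a))"
    by (subst v) (simp add: vec_eq_iff axis_def)
  moreover have "v $ i - of_int (\<lfloor>v $ i\<rfloor> - a) \<in> {of_int a .. of_int a + 1}"
    by simp linarith
  ultimately have "v - ?z \<in> axis i ` {of_int a .. of_int a + 1}" by (metis imageI)
  moreover have "?z \<in> int_lattice \<inter> coord_space {i}"
    by (auto intro!: axis_in_int_lattice axis_in_coord_space)
  ultimately show ?case by blast
next
  case (step S B i c \<mu> \<gamma>)
  let ?f = "of_int \<lfloor>\<gamma>\<rfloor> :: real"
  let ?P = "(\<lambda>x. ((1 / \<mu>) *\<^sub>R (x - c) + c) + axis i \<gamma>) ` B"
  let ?Q = "(\<lambda>t. c + axis i ((1 / (1 - \<mu>)) * (t - \<gamma>) + \<gamma>)) ` {?f .. ?f + 1}"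
  have "v - axis i (v $ i) \<in> coord_space S" using step.prems by (rule coord_space_minus_axis)
  then obtain z where z: "z \<in> int_lattice" "z \<in> coord_space S" "v - axis i (v $ i) - z \<in> B"
    using step.IH by blast
  define x where "x = v - axis i (v $ i) - z"
  define k where "k = \<lfloor>v $ i - ?f\<rfloor>"
  define t where "t = v $ i - of_int k"
  have t: "t \<in> {?f .. ?f + 1}" unfolding t_def k_def by simp linarith
  have "x \<in> B" using z(3) by (simp add: x_def)
  \<comment> \<open>Weights \<open>\<mu>\<close> and \<open>1 - \<mu>\<close> undo the two dilations
    of the construction, leaving the product point \<open>x + axis i t\<close>.\<close>
  have "\<mu> *\<^sub>R (((1 / \<mu>) *\<^sub>R (x - c) + c) + axis i \<gamma>) +
      (1 - \<mu>) *\<^sub>R (c + axis i ((1 / (1 - \<mu>)) * (t - \<gamma>) + \<gamma>)) \<in> convex hull (?P \<union> ?Q)"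
    using \<open>x \<in> B\<close> t step.hyps
    by (intro convexD[OF convex_convex_hull] hull_inc) auto
  also have "\<mu> *\<^sub>R (((1 / \<mu>) *\<^sub>R (x - c) + c) + axis i \<gamma>) +
      (1 - \<mu>) *\<^sub>R (c + axis i ((1 / (1 - \<mu>)) * (t - \<gamma>) + \<gamma>)) = x + axis i t"
    using step.hyps by (simp add: vec_eq_iff axis_def field_simps)
  also have "x + axis i t = v - (z + axis i (of_int k))"
    by (simp add: x_def t_def vec_eq_iff axis_def)
  finally have "v - (z + axis i (of_int k)) \<in> convex hull (?P \<union> ?Q)" .
  moreover have "z + axis i (of_int k) \<in> int_lattice"
    using z(1) by (intro int_lattice_add axis_in_int_lattice) auto
  moreover have "z + axis i (of_int k) \<in> coord_space (insert i S)"
    using z(2) coord_space_mono[of S "insert i S"] by (auto intro!: coord_space_intros)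
  ultimately show ?case by blast
qed

text \<open>The recursion data move along: the part of \<open>\<tau>\<close> in the old coordinates
  translates the smaller polytope and \<open>c\<close>, and the new coordinate shifts
  \<open>\<gamma>\<close> by an integer, hence its floor by the same integer.\<close>

lemma gen_cross_polytope_translate:
  assumes "gen_cross_polytope S X" "\<tau> \<in> int_lattice" "\<tau> \<in> coord_space S"
  shows "gen_cross_polytope S ((+) \<tau> ` X)"
  using assms
proof (induction arbitrary: \<tau> rule: gen_cross_polytope.induct)
  case (base a i)
  have "\<tau> $ i \<in> \<int>" using base by (simp add: int_lattice_def)
  then obtain k :: int where k: "\<tau> $ i = of_int k" by (auto elim: Ints_cases)
  then have \<tau>: "\<tau> = axis i (of_int k)"
    using base by (auto simp: coord_space_def vec_eq_iff axis_def)
  have "(+) \<tau> ` axis i ` {of_int a .. of_int a + 1 :: real} = (\<lambda>t. axis i (of_int k + t)) ` {of_int a .. of_int a + 1}"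
    unfolding \<tau> image_image by (intro image_cong refl) (simp add: vec_eq_iff axis_def)
  also have "\<dots> = axis i ` (+) (of_int k) ` {of_int a .. of_int a + 1}"
    by (simp only: image_image)
  also have "(+) (of_int k :: real) ` {of_int a .. of_int a + 1} = {of_int (k + a) .. of_int (k + a) + 1}"
    by (simp add: add.assoc)
  finally show ?case
    using gen_cross_polytope.base[of i "k + a"] by simp
next
  case (step S B i c \<mu> \<gamma>)
  have "\<tau> $ i \<in> \<int>" using step.prems by (simp add: int_lattice_def)
  then obtain k :: int where k: "\<tau> $ i = of_int k" by (auto elim: Ints_cases)
  define \<sigma> where "\<sigma> = \<tau> - axis i (of_int k)"
  have \<tau>: "\<tau> = \<sigma> + axis i (of_int k)" by (simp add: \<sigma>_def)
  have \<sigma>: "\<sigma> \<in> int_lattice" "\<sigma> \<in> coord_space S"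
    using step.prems coord_space_minus_axis[of \<tau> i S] k
    by (auto simp: \<sigma>_def intro!: int_lattice_diff axis_in_int_lattice)
  let ?P = "(\<lambda>x. ((1 / \<mu>) *\<^sub>R (x - c) + c) + axis i \<gamma>) ` B"
  let ?Q = "(\<lambda>t. c + axis i ((1 / (1 - \<mu>)) * (t - \<gamma>) + \<gamma>)) ` {of_int \<lfloor>\<gamma>\<rfloor> .. of_int \<lfloor>\<gamma>\<rfloor> + 1}"
  let ?P' = "(\<lambda>x. ((1 / \<mu>) *\<^sub>R (x - (\<sigma> + c)) + (\<sigma> + c)) + axis i (k + \<gamma>)) ` (+) \<sigma> ` B"
  let ?Q' = "(\<lambda>t. (\<sigma> + c) + axis i ((1 / (1 - \<mu>)) * (t - (k + \<gamma>)) + (k + \<gamma>))) `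
     {of_int \<lfloor>k + \<gamma>\<rfloor> .. of_int \<lfloor>k + \<gamma>\<rfloor> + 1}"
  have "gen_cross_polytope (insert i S) (convex hull (?P' \<union> ?Q'))"
    using step.hyps step.IH[OF \<sigma>] by (intro gen_cross_polytope.step) auto
  moreover have "?P' = (+) \<tau> ` ?P"
    unfolding image_image \<tau> by (intro image_cong refl) (simp add: vec_eq_iff axis_def)
  moreover have "?Q' = (+) \<tau> ` ?Q"
  proof -
    have "{of_int \<lfloor>k + \<gamma>\<rfloor> .. of_int \<lfloor>k + \<gamma>\<rfloor> + 1} = (+) (of_int k) ` {of_int \<lfloor>\<gamma>\<rfloor> .. of_int \<lfloor>\<gamma>\<rfloor> + 1 :: real}"
      by (simp add: add.assoc)
    then show ?thesis
      unfolding image_image \<tau> by (simp only: image_image) (intro image_cong refl, simp add: vec_eq_iff axis_def)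
  qed
  ultimately have "gen_cross_polytope (insert i S) (convex hull ((+) \<tau> ` ?P \<union> (+) \<tau> ` ?Q))"
    by simp
  then show ?case
    by (simp only: image_Un[symmetric] convex_hull_translation)
qed

section \<open>Lattice automorphisms and generalized cross-polyhedra\<close>

text \<open>The integral general linear group on the coordinates \<open>S\<close>, extended by the
  identity to the whole space so that all dimensions of the induction share one type.\<close>

definition lattice_aut :: "'n set \<Rightarrow> (real ^ 'n \<Rightarrow> real ^ 'n) \<Rightarrow> bool" where
  "lattice_aut S f \<longleftrightarrow> linear f \<and> bij f \<and> f ` int_lattice = int_lattice \<and>
     f ` coord_space S = coord_space S \<and> (\<forall>j. j \<notin> S \<longrightarrow> f (axis j 1) = axis j 1)"

lemma lattice_aut_coord_space: "lattice_aut S f \<Longrightarrow> x \<in> coord_space S \<Longrightarrow> f x \<in> coord_space S"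
  and lattice_aut_int_lattice: "lattice_aut S f \<Longrightarrow> x \<in> int_lattice \<Longrightarrow> f x \<in> int_lattice"
  and lattice_aut_linear: "lattice_aut S f \<Longrightarrow> linear f"
  by (auto simp: lattice_aut_def)

lemma lattice_aut_id: "lattice_aut S (\<lambda>x. x)"
  by (auto simp: lattice_aut_def linear_id[unfolded id_def] bij_id[unfolded id_def])

lemma lattice_aut_comp:
  assumes "lattice_aut S f" "lattice_aut S g"
  shows "lattice_aut S (\<lambda>x. f (g x))"
  using assms linear_compose[of g f] bij_comp[of g f]
  by (auto simp: lattice_aut_def o_def image_image[symmetric])

lemma lattice_aut_inv:
  assumes "lattice_aut S f"
  shows "lattice_aut S (inv f)"
proof -
  have f: "linear f" "bij f" using assms by (auto simp: lattice_aut_def)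
  have "inv f ` A = A" if "f ` A = A" for A
    using that f(2) by (metis bij_is_inj image_inv_f_f)
  moreover have "linear (inv f)"
    using f by (simp add: bij_is_inj inj_linear_imp_inv_linear)
  moreover have "inv f x = x" if "f x = x" for x
    using that f(2) by (metis bij_is_inj inv_f_eq)
  ultimately show ?thesis
    using assms by (auto simp: lattice_aut_def bij_imp_bij_inv)
qed

lemma lattice_aut_inv_cancel:
  assumes "lattice_aut S f"
  shows "f (inv f x) = x" "inv f (f x) = x"
  using assms by (auto simp: lattice_aut_def bij_is_surj surj_f_inv_f bij_is_inj)

lemma lattice_aut_axis:
  assumes "lattice_aut S f" "i \<notin> S"
  shows "f (axis i r) = axis i r"
proof -
  have "f (r *\<^sub>R axis i 1) = r *\<^sub>R f (axis i 1)"
    using assms by (intro linear_cmul) (simp add: lattice_aut_def)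
  then show ?thesis
    using assms by (simp add: lattice_aut_def flip: axis_eq_scaleR)
qed

lemma lattice_aut_insert:
  assumes f: "lattice_aut S f" and "i \<notin> S"
  shows "lattice_aut (insert i S) f"
proof -
  \<comment> \<open>Stated for an arbitrary automorphism \<open>g\<close> because the reverse
    inclusion needs it for \<open>inv f\<close>.\<close>
  have sub: "g ` coord_space (insert i S) \<subseteq> coord_space (insert i S)" if g: "lattice_aut S g" for g
  proof clarify
    fix x assume x: "x \<in> coord_space (insert i S)"
    have lin: "linear g" using g by (simp add: lattice_aut_def)
    have "g (x - axis i (x $ i)) \<in> coord_space S"
      using coord_space_minus_axis[OF x] g by (auto simp: lattice_aut_def)
    then have "g (x - axis i (x $ i)) \<in> coord_space (insert i S)"
      using coord_space_mono[of S "insert i S"] by blast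
    moreover have "g x = g (x - axis i (x $ i)) + axis i (x $ i)"
      using lattice_aut_axis[OF g \<open>i \<notin> S\<close>, of "x $ i"] by (simp add: linear_diff[OF lin])
    ultimately show "g x \<in> coord_space (insert i S)"
      by (auto intro!: coord_space_intros)
  qed
  have "f ` coord_space (insert i S) = coord_space (insert i S)"
  proof (rule antisym[OF sub[OF f]])
    show "coord_space (insert i S) \<subseteq> f ` coord_space (insert i S)"
    proof
      fix x assume "x \<in> coord_space (insert i S)"
      then have "inv f x \<in> coord_space (insert i S)"
        using sub[OF lattice_aut_inv[OF f]] by blast
      moreover have "x = f (inv f x)"
        using f by (simp add: lattice_aut_def bij_is_surj surj_f_inv_f)
      ultimately show "x \<in> f ` coord_space (insert i S)" by blast
    qed
  qed
  then show ?thesis using f by (auto simp: lattice_aut_def)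
qed

lemma lattice_autI:
  assumes "linear f" "\<And>x. g (f x) = x" "\<And>x. f (g x) = x"
    and "\<And>x. x \<in> int_lattice \<Longrightarrow> f x \<in> int_lattice" "\<And>x. x \<in> int_lattice \<Longrightarrow> g x \<in> int_lattice"
    and "\<And>x. x \<in> coord_space S \<Longrightarrow> f x \<in> coord_space S" "\<And>x. x \<in> coord_space S \<Longrightarrow> g x \<in> coord_space S"
    and "\<And>j. j \<notin> S \<Longrightarrow> f (axis j 1) = axis j 1"
  shows "lattice_aut S f"
proof -
  have "bij f" using assms(2,3) by (intro o_bij[of g f]) auto
  moreover have "f ` A = A" if "\<And>x. x \<in> A \<Longrightarrow> f x \<in> A" "\<And>x. x \<in> A \<Longrightarrow> g x \<in> A" for A
    using that assms(3) by (metis image_eqI image_subsetI subsetI subset_antisym)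
  ultimately show ?thesis using assms by (simp add: lattice_aut_def)
qed

lemma lattice_aut_shear:
  assumes "i \<in> S" "z \<in> int_lattice" "z \<in> coord_space S" "z $ i = 0"
  shows "lattice_aut S (\<lambda>x. x + (x $ i) *\<^sub>R z)"
proof (rule lattice_autI[where g = "\<lambda>x. x - (x $ i) *\<^sub>R z"])
  show "linear (\<lambda>x. x + (x $ i) *\<^sub>R z)"
    by (intro linearI) (simp_all add: algebra_simps)
  show "axis j 1 + (axis j 1 $ i) *\<^sub>R z = axis j 1" if "j \<notin> S" for j
    using that \<open>i \<in> S\<close> by (auto simp: axis_def)
qed (use assms in \<open>auto simp: int_lattice_def coord_space_def\<close>)

lemma lattice_aut_reflect:
  fixes i :: "'n::finite"
  assumes "i \<in> S"
  shows "lattice_aut S (\<lambda>x :: real ^ 'n. x - axis i (2 * x $ i))"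
proof (rule lattice_autI[where g = "\<lambda>x. x - axis i (2 * x $ i)"])
  show "linear (\<lambda>x :: real ^ 'n. x - axis i (2 * x $ i))"
    by (intro linearI) (simp_all add: vec_eq_iff axis_def algebra_simps)
qed (use assms in \<open>auto simp: int_lattice_def coord_space_def axis_def vec_eq_iff\<close>)

section \<open>Unimodularity, and generalized cross-polyhedra inside coordinate subspaces\<close>

lemma det_in_Ints:
  fixes A :: "real ^ 'n ^ 'n"
  assumes "\<And>i j. A $ i $ j \<in> \<int>"
  shows "det A \<in> \<int>"
  unfolding det_def using assms by (intro Ints_sum Ints_mult Ints_prod) auto

text \<open>The determinants of \<open>f\<close> and of its inverse are integers with product
  1.\<close>

lemma lattice_aut_unimodular:
  assumes f: "lattice_aut S f"
  shows "unimodular (matrix f)"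
proof -
  have ent: "matrix g $ i $ j \<in> \<int>" if "lattice_aut S g" for g i j
  proof -
    have "g (axis j 1) \<in> int_lattice"
      using that axis_in_int_lattice[of 1 j] by (auto simp: lattice_aut_def)
    then show ?thesis by (simp add: matrix_def int_lattice_def)
  qed
  have f': "lattice_aut S (inv f)" using f by (rule lattice_aut_inv)
  have lin: "linear f" "linear (inv f)" "bij f"
    using f f' by (auto simp: lattice_aut_def)
  have "matrix f ** matrix (inv f) = matrix (f \<circ> inv f)"
    using lin by (simp add: matrix_compose)
  also have "f \<circ> inv f = id" using lin(3) by (simp add: bij_is_surj surj_iff[symmetric])
  finally have "det (matrix f) * det (matrix (inv f)) = 1"
    by (metis det_I det_mul matrix_id)
  moreover obtain m n :: int where "det (matrix f) = of_int m" "det (matrix (inv f)) = of_int n"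
    using det_in_Ints[OF ent[OF f]] det_in_Ints[OF ent[OF f']] by (metis Ints_cases)
  ultimately have "m * n = 1" by (metis of_int_eq_1_iff of_int_mult)
  then have "m = 1 \<or> m = - 1" by (simp add: zmult_eq_1_iff) blast
  then show ?thesis
    using ent[OF f] \<open>det (matrix f) = of_int m\<close> by (auto simp: unimodular_def)
qed

text \<open>Generalized cross-polyhedra relative to \<open>coord_space S\<close>: \<open>f\<close>
  stands for the unimodular matrix and \<open>S - T\<close> for the free coordinates.\<close>

definition cross_sets :: "'n set \<Rightarrow> (real ^ 'n) set set" where
  "cross_sets S = {f ` {x + w |x w. x \<in> X \<and> w \<in> coord_space (S - T)} |f X T.
     lattice_aut S f \<and> gen_cross_polytope T X \<and> T \<subseteq> S}"

lemma cross_sets_UNIV: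
  assumes "G \<in> cross_sets UNIV"
  shows "gen_cross_polyhedron G"
proof -
  obtain f X T where f: "lattice_aut UNIV f" and X: "gen_cross_polytope T X"
    and G: "G = f ` {x + w |x w. x \<in> X \<and> w \<in> coord_space (UNIV - T)}"
    using assms by (auto simp: cross_sets_def)
  have "linear f" using f by (simp add: lattice_aut_def)
  then have "f = (*v) (matrix f)" by (auto simp: matrix_works)
  moreover have "{x + w |x w. x \<in> X \<and> w \<in> coord_space (UNIV - T)} = {x + w |x w. x \<in> X \<and> (\<forall>i\<in>T. w $ i = 0)}"
    by (auto simp: coord_space_def)
  ultimately have "G = (*v) (matrix f) ` {x + w |x w. x \<in> X \<and> (\<forall>i\<in>T. w $ i = 0)}"
    using G by metis
  then show ?thesis
    unfolding gen_cross_polyhedron_def using lattice_aut_unimodular[OF f] X by blast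
qed

lemma cross_sets_aut:
  assumes "G \<in> cross_sets S" "lattice_aut S f"
  shows "f ` G \<in> cross_sets S"
proof -
  obtain g X T where g: "lattice_aut S g" and X: "gen_cross_polytope T X" "T \<subseteq> S"
    and G: "G = g ` {x + w |x w. x \<in> X \<and> w \<in> coord_space (S - T)}"
    using assms by (auto simp: cross_sets_def)
  have "f ` G = (\<lambda>x. f (g x)) ` {x + w |x w. x \<in> X \<and> w \<in> coord_space (S - T)}"
    unfolding G image_image ..
  then show ?thesis
    unfolding cross_sets_def using lattice_aut_comp[OF assms(2) g] X by blast
qed

lemma coord_space_split:
  assumes "T \<subseteq> S" "v \<in> coord_space S"
  obtains u w where "v = u + w" "u \<in> coord_space T" "w \<in> coord_space (S - T)"
    "v \<in> int_lattice \<longrightarrow> u \<in> int_lattice \<and> w \<in> int_lattice"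
proof -
  let ?u = "(\<chi> j. if j \<in> T then v $ j else 0)"
  let ?w = "(\<chi> j. if j \<in> T then 0 else v $ j)"
  show thesis
    by (rule that[of ?u ?w]) (use assms in \<open>auto simp: vec_eq_iff coord_space_def int_lattice_def\<close>)
qed

text \<open>After pulling \<open>\<tau>\<close> back through \<open>f\<close>, its part on
  \<open>T\<close> translates the polytope and its part on \<open>S - T\<close> disappears in the
  linear factor.\<close>

lemma cross_sets_translate:
  assumes "G \<in> cross_sets S" and \<tau>: "\<tau> \<in> int_lattice" "\<tau> \<in> coord_space S"
  shows "(+) \<tau> ` G \<in> cross_sets S"
proof -
  obtain f X T where f: "lattice_aut S f" and X: "gen_cross_polytope T X" "T \<subseteq> S"
    and G: "G = f ` {x + w |x w. x \<in> X \<and> w \<in> coord_space (S - T)}"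
    using assms by (auto simp: cross_sets_def)
  have "\<tau> \<in> f ` (int_lattice \<inter> coord_space S)"
    using f \<tau> by (auto simp: lattice_aut_def image_Int bij_is_inj)
  then obtain v where v: "v \<in> int_lattice" "v \<in> coord_space S" "\<tau> = f v" by auto
  obtain u w where uw: "v = u + w" "u \<in> coord_space T" "w \<in> coord_space (S - T)" "u \<in> int_lattice"
    using coord_space_split[OF X(2) v(2)] v(1) by metis
  have "linear f" using f by (simp add: lattice_aut_def)
  then have "(+) \<tau> ` G = f ` ((+) v ` {x + w |x w. x \<in> X \<and> w \<in> coord_space (S - T)})"
    unfolding G image_image v(3) by (simp add: linear_add)
  also have "(+) v ` {x + w |x w. x \<in> X \<and> w \<in> coord_space (S - T)} =
      {x + w |x w. x \<in> (+) u ` X \<and> w \<in> coord_space (S - T)}"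
  proof (intro antisym subsetI)
    fix y assume "y \<in> (+) v ` {x + w |x w. x \<in> X \<and> w \<in> coord_space (S - T)}"
    then obtain x' w' where "x' \<in> X" "w' \<in> coord_space (S - T)" "y = v + (x' + w')" by auto
    then have "y = (u + x') + (w + w')" "u + x' \<in> (+) u ` X" "w + w' \<in> coord_space (S - T)"
      using uw by (auto intro: coord_space_intros)
    then show "y \<in> {x + w |x w. x \<in> (+) u ` X \<and> w \<in> coord_space (S - T)}" by blast
  next
    fix y assume "y \<in> {x + w |x w. x \<in> (+) u ` X \<and> w \<in> coord_space (S - T)}"
    then obtain x' w' where "x' \<in> X" "w' \<in> coord_space (S - T)" "y = (u + x') + w'" by auto
    then have "y = v + (x' + (w' - w))" "x' \<in> X" "w' - w \<in> coord_space (S - T)"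
      using uw by (auto intro: coord_space_intros)
    then show "y \<in> (+) v ` {x + w |x w. x \<in> X \<and> w \<in> coord_space (S - T)}" by blast
  qed
  finally show ?thesis
    unfolding cross_sets_def using f X(2) gen_cross_polytope_translate[OF X(1) uw(4,2)] by blast
qed

lemma cross_sets_covering:
  assumes "G \<in> cross_sets S" "v \<in> coord_space S"
  shows "\<exists>z\<in>int_lattice \<inter> coord_space S. v - z \<in> G"
proof -
  obtain f X T where f: "lattice_aut S f" and X: "gen_cross_polytope T X" "T \<subseteq> S"
    and G: "G = f ` {x + w |x w. x \<in> X \<and> w \<in> coord_space (S - T)}"
    using assms by (auto simp: cross_sets_def)
  have lin: "linear f" using f by (simp add: lattice_aut_def)
  obtain v' where v': "v' \<in> coord_space S" "v = f v'"
    using f assms(2) by (metis imageE lattice_aut_def)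
  obtain u w where uw: "v' = u + w" "u \<in> coord_space T" "w \<in> coord_space (S - T)"
    using coord_space_split[OF X(2) v'(1)] by metis
  obtain z where z: "z \<in> int_lattice" "z \<in> coord_space T" "u - z \<in> X"
    using gen_cross_polytope_covering[OF X(1) uw(2)] by blast
  have "v - f z = f ((u - z) + w)"
    using lin uw v' by (simp add: linear_diff linear_add)
  then have "v - f z \<in> G" unfolding G using z uw by blast
  moreover have "f z \<in> int_lattice \<inter> coord_space S"
    using f z coord_space_mono[OF X(2)] by (auto simp: lattice_aut_def)
  ultimately show ?thesis by blast
qed

lemma cross_sets_convex:
  assumes "G \<in> cross_sets S"
  shows "convex G"
proof -
  obtain f X T where f: "lattice_aut S f" and X: "gen_cross_polytope T X" "T \<subseteq> S"
    and G: "G = f ` {x + w |x w. x \<in> X \<and> w \<in> coord_space (S - T)}"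
    using assms by (auto simp: cross_sets_def)
  have "{x + w |x w. x \<in> X \<and> w \<in> coord_space (S - T)} = (\<Union>x\<in>X. \<Union>w\<in>coord_space (S - T). {x + w})"
    by auto
  moreover have "convex \<dots>"
    by (intro convex_sums gen_cross_polytope_convex[OF X(1)] subspace_imp_convex subspace_coord_space)
  ultimately show ?thesis
    unfolding G using f by (auto simp: lattice_aut_def intro: convex_linear_image)
qed

text \<open>Cramer's rule makes the preimage of a lattice point under an integer matrix of determinant
  \<open>\<plusminus>1\<close> integral.\<close>

lemma unimodular_solve:
  fixes U :: "real ^ 'n ^ 'n"
  assumes U: "unimodular U" and z: "z \<in> int_lattice"
  shows "\<exists>w\<in>int_lattice. U *v w = z"
proof -
  have d: "det U = 1 \<or> det U = - 1" and ent: "\<And>i j. U $ i $ j \<in> \<int>"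
    using U by (auto simp: unimodular_def)
  define w where "w = (\<chi> k. det (\<chi> i j. if j = k then z $ i else U $ i $ j) / det U)"
  have "U *v w = z"
    using cramer[of U w z] d by (auto simp: w_def)
  moreover have "det (\<chi> i j. if j = k then z $ i else U $ i $ j) \<in> \<int>" for k
    using z ent by (intro det_in_Ints) (auto simp: int_lattice_def)
  then have "w \<in> int_lattice"
    using d by (auto simp: w_def int_lattice_def)
  ultimately show ?thesis by blast
qed

text \<open>A lattice point in the interior pulls back under \<open>U\<close> to a lattice point
  \<open>w\<close>, and the functional separating \<open>w\<close> from \<open>X\<close> vanishes on
  the linear factor; a small step from \<open>w\<close> in its direction would stay in the set and
  violate the separation.\<close>

lemma cross_family_lattice_free:
  assumes "B \<in> cross_family b"
  shows "lattice_free b B"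
proof -
  obtain G where B: "B = (+) b ` G" and G: "gen_cross_polyhedron G" and b: "- b \<in> interior G"
    using assms by (auto simp: cross_family_def)
  obtain S X U where X: "gen_cross_polytope S X" and U: "unimodular U"
    and GX: "G = (*v) U ` {x + w |x w. x \<in> X \<and> (\<forall>i\<in>S. w $ i = 0)}"
    using G by (auto simp: gen_cross_polyhedron_def)
  let ?W = "coord_space (- S) :: (real ^ 'a) set"
  define Y where "Y = (\<Union>x\<in>X. \<Union>w\<in>?W. {x + w})"
  have GY: "G = (*v) U ` Y"
    unfolding GX Y_def by (intro arg_cong[of _ _ "\<lambda>A. (*v) U ` A"]) (auto simp: coord_space_def)
  have "invertible U" using U by (auto simp: unimodular_def invertible_det_nz)
  then have inj: "inj ((*v) U)" by (simp add: inj_matrix_vector_mult)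
  have "closed Y"
    unfolding Y_def by (rule compact_closed_sums[OF gen_cross_polytope_compact[OF X] closed_coord_space])
  then have closed: "closed G"
    unfolding GY using inj by (intro closed_injective_linear_image) (auto simp: inj_def)
  have "convex Y"
    unfolding Y_def
    by (intro convex_sums gen_cross_polytope_convex[OF X] subspace_imp_convex subspace_coord_space)
  then have convex: "convex G"
    unfolding GY by (intro convex_linear_image) auto
  have free: "z \<notin> interior G" if z: "z \<in> int_lattice" for z
  proof
    assume zG: "z \<in> interior G"
    obtain w where w: "w \<in> int_lattice" "U *v w = z" using unimodular_solve[OF U z] by blast
    obtain a where a: "a \<in> coord_space S" "a \<noteq> 0" "\<And>x. x \<in> X \<Longrightarrow> a \<bullet> x \<le> a \<bullet> w"
      using gen_cross_polytope_separated[OF X w(1)] by blast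
    have aw: "a \<bullet> v = 0" if "v \<in> ?W" for v
    proof -
      have "a $ j = 0 \<or> v $ j = 0" for j
        using a(1) that by (cases "j \<in> S") (auto simp: coord_space_def)
      then show ?thesis
        unfolding inner_vec_def by (intro sum.neutral) auto
    qed
    have aY: "a \<bullet> y \<le> a \<bullet> w" if "y \<in> Y" for y
      using that a(3) aw by (auto simp: Y_def inner_add_right)
    have "open ((*v) U -` interior G)"
      by (rule open_vimage[OF open_interior linear_continuous_on[OF matrix_vector_mul_bounded_linear]])
    moreover have "w \<in> (*v) U -` interior G" using zG w by simp
    ultimately obtain e where e: "e > 0" "cball w e \<subseteq> (*v) U -` interior G"
      using open_contains_cball by blast
    define y where "y = w + (e / norm a) *\<^sub>R a"
    have "y \<in> cball w e" using a(2) e(1) by (simp add: y_def dist_norm)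
    then have "U *v y \<in> G" using e(2) interior_subset by blast
    then have "y \<in> Y" using inj by (auto simp: GY inj_def)
    then have "(e / norm a) * (a \<bullet> a) \<le> 0" using aY[of y] by (simp add: y_def inner_add_right)
    moreover have "(e / norm a) * (a \<bullet> a) > 0" using e(1) a(2) by simp
    ultimately show False by simp
  qed
  have int: "interior B = (+) b ` interior G" unfolding B by (rule interior_translation)
  show ?thesis
    unfolding lattice_free_def
  proof (intro conjI)
    show "closed B" unfolding B using closed by (rule closed_translation)
    show "convex B" unfolding B using convex by (rule convex_translation)
    show "0 \<in> interior B" unfolding int using b by (rule image_eqI[rotated]) simp
    show "interior B \<inter> (+) b ` int_lattice = {}" unfolding int using free by auto
  qed
qed

lemma M_closure_subset_G_closure: "M_closure b R P \<subseteq> G_closure b R P"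
  unfolding G_closure_def
proof (rule INT_greatest)
  fix B assume "B \<in> cross_family b"
  then have B: "lattice_free b B" by (rule cross_family_lattice_free)
  obtain C where C: "maximal_lattice_free b C" "B \<subseteq> C"
    using lattice_free_imp_subset_maximal[OF B] by blast
  have "M_closure b R P \<subseteq> H C R P" using C(1) by (auto simp: M_closure_def)
  also have "\<dots> \<subseteq> H B R P"
    using B C(2) by (intro H_mono) (auto simp: lattice_free_def)
  finally show "M_closure b R P \<subseteq> H B R P" .
qed

section \<open>Integer functionals\<close>

text \<open>The nonzero vectors of the dual lattice on \<open>S\<close>, as the directions in which
  lattice width is measured.\<close>

definition int_functional :: "'n set \<Rightarrow> (real ^ 'n \<Rightarrow> real) \<Rightarrow> bool" where
  "int_functional S \<phi> \<longleftrightarrow> linear \<phi> \<and> (\<forall>z\<in>int_lattice. \<phi> z \<in> \<int>) \<and> (\<exists>x\<in>coord_space S. \<phi> x \<noteq> 0)"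

lemma int_functional_nth: "i \<in> S \<Longrightarrow> int_functional S (\<lambda>x. x $ i)"
  unfolding int_functional_def
  by (intro conjI linearI ballI bexI[of _ "axis i 1"] axis_in_coord_space)
     (auto simp: int_lattice_def)

lemma int_functional_comp:
  assumes f: "lattice_aut S f" and \<phi>: "int_functional S \<phi>"
  shows "int_functional S (\<lambda>x. \<phi> (f x))"
proof -
  have "linear (\<lambda>x. \<phi> (f x))"
    using linear_compose[of f \<phi>] f \<phi> by (simp add: o_def lattice_aut_def int_functional_def)
  moreover obtain x where "x \<in> coord_space S" "\<phi> x \<noteq> 0"
    using \<phi> by (auto simp: int_functional_def)
  moreover obtain y where "y \<in> coord_space S" "x = f y"
    using f \<open>x \<in> coord_space S\<close> by (metis imageE lattice_aut_def)
  moreover have "f z \<in> int_lattice" if "z \<in> int_lattice" for z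
    using f that by (auto simp: lattice_aut_def)
  ultimately show ?thesis
    using \<phi> by (auto simp: int_functional_def)
qed

lemma int_functional_add_nth:
  assumes "int_functional S \<phi>" "i \<notin> S" "k \<in> \<int>"
  shows "int_functional (insert i S) (\<lambda>x. \<phi> x + k * x $ i)"
proof -
  have lin: "linear \<phi>" and Z: "\<And>z. z \<in> int_lattice \<Longrightarrow> \<phi> z \<in> \<int>"
    using assms by (auto simp: int_functional_def)
  obtain x where x: "x \<in> coord_space S" "\<phi> x \<noteq> 0"
    using assms by (auto simp: int_functional_def)
  have "linear (\<lambda>x. \<phi> x + k * x $ i)"
    by (intro linearI) (simp_all add: linear_add[OF lin] linear_cmul[OF lin] algebra_simps)
  moreover have "\<phi> z + k * z $ i \<in> \<int>" if "z \<in> int_lattice" for z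
    using Z[OF that] that assms(3) by (auto simp: int_lattice_def)
  moreover have "x $ i = 0" using x(1) assms(2) by (rule coord_space_nth)
  moreover have "x \<in> coord_space (insert i S)"
    using x(1) coord_space_mono[of S "insert i S"] by blast
  ultimately show ?thesis
    unfolding int_functional_def using x(2) by (auto intro!: bexI[of _ x])
qed

text \<open>One-dimensional Hahn--Banach: each point of \<open>K\<close> above the hyperplane \<open>x $ i = 0\<close> bounds the
  slope from above, each point below it from below, and the two kinds of bounds are compatible because
  the segment joining such points meets the slice.\<close>

lemma slice_functional_extension:
  fixes K :: "(real ^ 'n) set" and \<phi> :: "real ^ 'n \<Rightarrow> real"
  assumes K: "convex K" and lin: "linear \<phi>"
    and slice: "\<And>x. x \<in> K \<Longrightarrow> x $ i = 0 \<Longrightarrow> \<phi> x \<le> a"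
    and u: "u \<in> K" "u $ i > 0" and v: "v \<in> K" "v $ i < 0"
  shows "\<exists>\<beta>. \<forall>x\<in>K. \<phi> x + \<beta> * x $ i \<le> a"
proof -
  \<comment> \<open>\<open>lo x\<close> is the slope for which the inequality is tight at
    \<open>x\<close>.\<close>
  define lo where "lo x = (a - \<phi> x) / x $ i" for x
  have key: "lo y \<le> lo x" if x: "x \<in> K" "x $ i > 0" and y: "y \<in> K" "y $ i < 0" for x y
  proof -
    define t s where "t = x $ i" and "s = - y $ i"
    have ts: "t > 0" "s > 0" using x y by (auto simp: t_def s_def)
    define w where "w = (s / (s + t)) *\<^sub>R x + (t / (s + t)) *\<^sub>R y"
    have "w \<in> K"
      unfolding w_def using ts x(1) y(1)
      by (intro convexD[OF K]) (simp_all flip: add_divide_distrib)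
    moreover have "w $ i = 0"
      using ts by (simp add: w_def field_simps) (simp add: t_def s_def)
    ultimately have "\<phi> w \<le> a" by (rule slice)
    then have "(s * \<phi> x + t * \<phi> y) / (s + t) \<le> a"
      by (simp add: w_def linear_add[OF lin] linear_cmul[OF lin] add_divide_distrib)
    then have "s * \<phi> x + t * \<phi> y \<le> a * (s + t)"
      using ts by (simp add: divide_le_eq)
    then have "(\<phi> y - a) / s \<le> (a - \<phi> x) / t"
      using ts by (simp add: field_simps)
    moreover have "(\<phi> y - a) / s = lo y"
      unfolding lo_def s_def using y by (simp add: field_simps)
    ultimately show ?thesis by (simp add: lo_def t_def)
  qed
  define \<beta> where "\<beta> = Sup (lo ` {y \<in> K. y $ i < 0})"
  have bdd: "bdd_above (lo ` {y \<in> K. y $ i < 0})"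
    using key[OF u] by (intro bdd_aboveI[of _ "lo u"]) auto
  have "\<phi> x + \<beta> * x $ i \<le> a" if x: "x \<in> K" for x
  proof (cases "x $ i" "0 :: real" rule: linorder_cases)
    case less
    then have "lo x \<le> \<beta>"
      unfolding \<beta>_def using bdd x by (intro cSup_upper) auto
    then show ?thesis using less by (simp add: lo_def field_simps)
  next
    case equal
    then show ?thesis using slice x by simp
  next
    case greater
    then have "\<beta> \<le> lo x"
      unfolding \<beta>_def using key[OF x greater] v by (intro cSup_least) auto
    then show ?thesis using greater by (simp add: lo_def field_simps)
  qed
  then show ?thesis by blast
qed

lemma linear_functional_expand:
  fixes \<phi> :: "real ^ 'n \<Rightarrow> real"
  assumes "linear \<phi>"
  shows "\<phi> x = (\<Sum>j\<in>UNIV. x $ j * \<phi> (axis j 1))"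
proof -
  have "\<phi> x = \<phi> (\<Sum>j\<in>UNIV. (x $ j) *\<^sub>R axis j 1)"
    using basis_expansion[of x] by (simp add: scalar_mult_eq_scaleR)
  then show ?thesis
    using assms by (simp add: linear_sum linear_cmul)
qed

text \<open>Euclid's algorithm on the coefficients of \<open>\<phi>\<close>, by shears; the coefficient of the pivot \<open>i\<close> has
  weight one and the others weight two, so that a zero pivot can be replaced by another coefficient.\<close>

lemma int_functional_normal_form:
  fixes \<phi> :: "real ^ 'n \<Rightarrow> real"
  assumes i: "i \<in> S" and \<phi>: "linear \<phi>" "\<And>z. z \<in> int_lattice \<Longrightarrow> \<phi> z \<in> \<int>"
  shows "\<exists>f g. lattice_aut S f \<and> g \<in> \<int> \<and> (\<forall>x\<in>coord_space S. \<phi> (f x) = g * x $ i)"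
proof -
  let ?M = "\<lambda>\<phi> :: real ^ 'n \<Rightarrow> real. 2 * (\<Sum>j\<in>S - {i}. \<bar>\<phi> (axis j 1)\<bar>) + \<bar>\<phi> (axis i 1)\<bar>"
  \<comment> \<open>Generalized over \<open>\<phi>\<close>, with a natural bound \<open>m\<close> on
    the real-valued measure as induction variable; every round lowers the measure by at least
    one.\<close>
  have "\<exists>f g. lattice_aut S f \<and> g \<in> \<int> \<and> (\<forall>x\<in>coord_space S. \<phi> (f x) = g * x $ i)"
    if "linear \<phi>" "\<And>z. z \<in> int_lattice \<Longrightarrow> \<phi> z \<in> \<int>" "?M \<phi> \<le> real m" for m \<phi>
    using that
  proof (induction m arbitrary: \<phi> rule: less_induct)
    case (less m)
    note lin = less.prems(1) and Z = less.prems(2)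
    have cZ: "\<phi> (axis j 1) \<in> \<int>" for j by (intro Z axis_in_int_lattice) auto
    show ?case
    proof (cases "\<forall>j\<in>S - {i}. \<phi> (axis j 1) = 0")
      case True
      have "\<phi> x = \<phi> (axis i 1) * x $ i" if "x \<in> coord_space S" for x
      proof -
        have "\<phi> x = (\<Sum>j\<in>UNIV. if j = i then x $ i * \<phi> (axis i 1) else 0)"
          unfolding linear_functional_expand[OF lin, of x]
          using True that by (intro sum.cong) (auto simp: coord_space_def)
        then show ?thesis by simp
      qed
      then show ?thesis using lattice_aut_id cZ by blast
    next
      case False
      then obtain j where j: "j \<in> S" "j \<noteq> i" "\<phi> (axis j 1) \<noteq> 0" by blast
      have abs1: "\<bar>\<phi> (axis k 1)\<bar> \<ge> 1" if "\<phi> (axis k 1) \<noteq> 0" for k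
        using cZ[of k] that by (auto elim!: Ints_cases)
      have split: "?M \<psi> = 2 * (\<Sum>l\<in>S - {i} - {j}. \<bar>\<psi> (axis l 1)\<bar>) + 2 * \<bar>\<psi> (axis j 1)\<bar> + \<bar>\<psi> (axis i 1)\<bar>" for \<psi>
        using j by (subst sum.remove[of "S - {i}" j]) auto
      have "\<exists>f. lattice_aut S f \<and> (\<forall>l\<in>S - {i} - {j}. \<phi> (f (axis l 1)) = \<phi> (axis l 1)) \<and>
          2 * \<bar>\<phi> (f (axis j 1))\<bar> + \<bar>\<phi> (f (axis i 1))\<bar> \<le> 2 * \<bar>\<phi> (axis j 1)\<bar> + \<bar>\<phi> (axis i 1)\<bar> - 1"
      proof -
        define shear where "shear u v k = (\<lambda>x :: real ^ 'n. x + (x $ u) *\<^sub>R axis v k)" for u v and k :: real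
        have aut: "lattice_aut S (shear u v k)" if "u \<in> S" "v \<in> S" "u \<noteq> v" "k \<in> \<int>" for u v k
          unfolding shear_def using that
          by (intro lattice_aut_shear axis_in_int_lattice axis_in_coord_space) (auto simp: axis_def)
        have coeff: "\<phi> (shear u v k (axis l 1)) = \<phi> (axis l 1) + (if l = u then k * \<phi> (axis v 1) else 0)" for u v k l
          by (simp add: shear_def linear_add[OF lin] linear_cmul[OF lin] axis_eq_scaleR[of v k] axis_def[of l])
        consider "\<bar>\<phi> (axis i 1)\<bar> \<ge> \<bar>\<phi> (axis j 1)\<bar>" | "\<phi> (axis i 1) \<noteq> 0" "\<bar>\<phi> (axis i 1)\<bar> < \<bar>\<phi> (axis j 1)\<bar>"
          | "\<phi> (axis i 1) = 0" by linarith
        then show ?thesis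
        proof cases
          case 1
          define k where "k = - sgn (\<phi> (axis i 1)) * sgn (\<phi> (axis j 1))"
          have "k \<in> \<int>" by (auto simp: k_def sgn_if)
          moreover have "\<bar>\<phi> (axis i 1) + k * \<phi> (axis j 1)\<bar> = \<bar>\<phi> (axis i 1)\<bar> - \<bar>\<phi> (axis j 1)\<bar>"
            using 1 by (auto simp: k_def sgn_if)
          ultimately show ?thesis
            using aut[of i j k] i j abs1[of j] by (intro exI[of _ "shear i j k"]) (auto simp: coeff)
        next
          case 2
          define k where "k = - sgn (\<phi> (axis i 1)) * sgn (\<phi> (axis j 1))"
          have "k \<in> \<int>" by (auto simp: k_def sgn_if)
          moreover have "\<bar>\<phi> (axis j 1) + k * \<phi> (axis i 1)\<bar> = \<bar>\<phi> (axis j 1)\<bar> - \<bar>\<phi> (axis i 1)\<bar>"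
            using 2 by (auto simp: k_def sgn_if)
          ultimately show ?thesis
            using aut[of j i k] i j abs1[of i] 2 by (intro exI[of _ "shear j i k"]) (auto simp: coeff)
        next
          case 3
          \<comment> \<open>The composite sends \<open>axis j 1\<close> to \<open>- axis i 1\<close>
            and \<open>axis i 1\<close> to \<open>axis i 1 + axis j 1\<close>: the coefficient at
            \<open>j\<close> becomes zero and reappears at \<open>i\<close>, where it counts once
            instead of twice.\<close>
          have f: "lattice_aut S (\<lambda>x. shear i j 1 (shear j i (- 1) x))"
            using lattice_aut_comp[OF aut[of i j 1] aut[of j i "- 1"]] i j by simp
          have "shear i j 1 (shear j i (- 1) (axis l 1)) = axis l 1" if "l \<noteq> i" "l \<noteq> j" for l
            using that j by (auto simp: shear_def vec_eq_iff axis_def)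
          moreover have "shear i j 1 (shear j i (- 1) (axis j 1)) = - axis i 1"
            using j by (auto simp: shear_def vec_eq_iff axis_def)
          moreover have "shear i j 1 (shear j i (- 1) (axis i 1)) = axis i 1 + axis j 1"
            using j by (auto simp: shear_def vec_eq_iff axis_def)
          ultimately show ?thesis
            using f 3 abs1[OF j(3)]
            by (intro exI[of _ "\<lambda>x. shear i j 1 (shear j i (- 1) x)"])
               (auto simp: linear_neg[OF lin] linear_add[OF lin])
        qed
      qed
      then obtain f where f: "lattice_aut S f"
        and same: "\<And>l. l \<in> S - {i} - {j} \<Longrightarrow> \<phi> (f (axis l 1)) = \<phi> (axis l 1)"
        and dec: "2 * \<bar>\<phi> (f (axis j 1))\<bar> + \<bar>\<phi> (f (axis i 1))\<bar> \<le> 2 * \<bar>\<phi> (axis j 1)\<bar> + \<bar>\<phi> (axis i 1)\<bar> - 1"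
        by blast
      have "(\<Sum>l\<in>S - {i} - {j}. \<bar>\<phi> (f (axis l 1))\<bar>) = (\<Sum>l\<in>S - {i} - {j}. \<bar>\<phi> (axis l 1)\<bar>)"
        using same by (intro sum.cong) auto
      then have M: "?M (\<lambda>x. \<phi> (f x)) \<le> ?M \<phi> - 1"
        unfolding split[of "\<lambda>x. \<phi> (f x)"] split[of \<phi>] using dec by simp
      have "?M (\<lambda>x. \<phi> (f x)) \<ge> 0" by (intro add_nonneg_nonneg mult_nonneg_nonneg sum_nonneg) auto
      then have m: "m > 0" "?M (\<lambda>x. \<phi> (f x)) \<le> real (m - 1)"
        using M less.prems(3) by (cases m; simp; linarith)+
      have "linear (\<lambda>x. \<phi> (f x))"
        using linear_compose[of f \<phi>] f lin by (simp add: o_def lattice_aut_def)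
      moreover have "\<phi> (f z) \<in> \<int>" if "z \<in> int_lattice" for z
        using f that Z by (auto simp: lattice_aut_def)
      ultimately obtain f' g where f': "lattice_aut S f'" "g \<in> \<int>" "\<forall>x\<in>coord_space S. \<phi> (f (f' x)) = g * x $ i"
        using less.IH[of "m - 1" "\<lambda>x. \<phi> (f x)"] m by auto
      then show ?thesis using lattice_aut_comp[OF f f'(1)] by blast
    qed
  qed
  moreover have "?M \<phi> \<le> real (nat \<lceil>?M \<phi>\<rceil>)" by (rule real_nat_ceiling_ge)
  ultimately show ?thesis using \<phi> by blast
qed

section \<open>The flatness theorem\<close>

lemma symmetric_convex_scale:
  assumes "convex C" "\<And>x. x \<in> C \<Longrightarrow> - x \<in> C" "x \<in> C" "\<bar>r\<bar> \<le> 1"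
  shows "r *\<^sub>R x \<in> C"
proof -
  have "((1 + r) / 2) *\<^sub>R x + ((1 - r) / 2) *\<^sub>R (- x) \<in> C"
    using assms by (intro convexD) (auto simp: field_simps abs_le_iff)
  moreover have "((1 + r) / 2) *\<^sub>R x + ((1 - r) / 2) *\<^sub>R (- x) = r *\<^sub>R x"
    by (simp add: field_simps flip: scaleR_add_left scaleR_diff_left)
  ultimately show ?thesis by simp
qed

text \<open>The flatness theorem for symmetric sets in contrapositive form: half-width above
  \<open>F\<close> in all dual lattice directions forces every translate of \<open>C\<close> to meet
  the lattice.\<close>

definition symmetric_flat :: "'n::finite set \<Rightarrow> real \<Rightarrow> bool" where
  "symmetric_flat S F \<longleftrightarrow> (\<forall>C c. C \<subseteq> coord_space S \<longrightarrow> convex C \<longrightarrow> bounded C \<longrightarrow> C \<noteq> {} \<longrightarrow>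
      (\<forall>x\<in>C. - x \<in> C) \<longrightarrow> c \<in> coord_space S \<longrightarrow>
      (\<forall>\<phi>. int_functional S \<phi> \<longrightarrow> (\<exists>x\<in>C. \<phi> x > F)) \<longrightarrow> (\<exists>z\<in>int_lattice. z - c \<in> C))"

lemma symmetric_flatD:
  assumes "symmetric_flat S F" "C \<subseteq> coord_space S" "convex C" "bounded C" "C \<noteq> {}"
    and "\<And>x. x \<in> C \<Longrightarrow> - x \<in> C" "c \<in> coord_space S"
    and "\<And>\<phi>. int_functional S \<phi> \<Longrightarrow> \<exists>x\<in>C. \<phi> x > F"
  shows "\<exists>z\<in>int_lattice. z - c \<in> C"
  using assms unfolding symmetric_flat_def by presburger

text \<open>The functional \<open>x $ i\<close> is nearly minimal on \<open>C\<close>. A functional that is small on the slice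
  \<open>x $ i = 0\<close> extends to a small one on \<open>C\<close>, and rounding the extension costs at most half of the
  bound on \<open>x $ i\<close>; hence all functionals are large on the slice as well.\<close>

lemma symmetric_flatness_step:
  fixes C :: "(real ^ 'n) set"
  assumes i: "i \<notin> S" and F: "F \<ge> 1"
    and IH: "symmetric_flat S F"
    and C: "C \<subseteq> coord_space (insert i S)" "convex C" "bounded C"
    and sym: "\<And>x. x \<in> C \<Longrightarrow> - x \<in> C"
    and c: "c \<in> coord_space (insert i S)"
    and M: "M \<ge> 20 * F" "\<And>x. x \<in> C \<Longrightarrow> \<bar>x $ i\<bar> \<le> M"
    and big: "\<And>\<phi>. int_functional (insert i S) \<phi> \<Longrightarrow> \<exists>x\<in>C. \<phi> x > 2 / 3 * M"
  shows "\<exists>z\<in>int_lattice. z - c \<in> C"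
proof -
  \<comment> \<open>Half of the slice through the origin: the other half of \<open>C\<close> is
    reserved for moving \<open>c\<close> to integral height along \<open>v\<close>.\<close>
  define D where "D = {x. 2 *\<^sub>R x \<in> C \<and> x $ i = 0}"
  obtain v where v: "v \<in> C" "v $ i > 2 / 3 * M"
    using big[OF int_functional_nth[of i "insert i S"]] by auto
  have v1: "v $ i > 1" using v(2) M(1) F by linarith
  have scale: "r *\<^sub>R x \<in> C" if "x \<in> C" "\<bar>r\<bar> \<le> 1" for r x
    using symmetric_convex_scale[OF C(2) sym that] .
  have zeroC: "0 \<in> C" using scale[OF v(1), of 0] by simp
  have lin2: "linear (\<lambda>x :: real ^ 'n. 2 *\<^sub>R x)" by (rule linear_scaleR)
  have Dvim: "D = (\<lambda>x. 2 *\<^sub>R x) -` C \<inter> {x. x $ i = 0}" by (auto simp: D_def)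
  have D_C: "x \<in> C" if "x \<in> D" for x
    using scale[of "2 *\<^sub>R x" "1 / 2"] that by (simp add: D_def)
  have big_slice: "\<exists>x\<in>D. \<phi> x > F" if \<phi>: "int_functional S \<phi>" for \<phi>
  proof (rule ccontr)
    assume "\<not> ?thesis"
    then have small: "\<phi> x \<le> F" if "x \<in> D" for x using that by (auto simp: not_less)
    have lin: "linear \<phi>" using \<phi> by (simp add: int_functional_def)
    have slice: "\<phi> x \<le> 2 * F" if "x \<in> C" "x $ i = 0" for x
    proof -
      have "(1 / 2) *\<^sub>R x \<in> D" using that by (simp add: D_def)
      from small[OF this] show ?thesis by (simp add: linear_cmul[OF lin])
    qed
    have "\<exists>\<beta>. \<forall>x\<in>C. \<phi> x + \<beta> * x $ i \<le> 2 * F"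
      using sym v(1) v1 by (intro slice_functional_extension[OF C(2) lin slice, where u = v and v = "- v"]) auto
    then obtain \<beta> where \<beta>: "\<And>x. x \<in> C \<Longrightarrow> \<phi> x + \<beta> * x $ i \<le> 2 * F" by blast
    define k :: real where "k = of_int (round \<beta>)"
    have k: "\<bar>k - \<beta>\<bar> \<le> 1 / 2" unfolding k_def by (rule of_int_round_abs_le)
    obtain x where x: "x \<in> C" "\<phi> x + k * x $ i > 2 / 3 * M"
      using big[OF int_functional_add_nth[OF \<phi> i, of k]] by (auto simp: k_def)
    have "(k - \<beta>) * x $ i \<le> \<bar>k - \<beta>\<bar> * \<bar>x $ i\<bar>" by (simp flip: abs_mult)
    also have "\<dots> \<le> 1 / 2 * M" using k M(2)[OF x(1)] by (intro mult_mono) auto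
    finally have "\<phi> x + k * x $ i \<le> 2 * F + 1 / 2 * M"
      using \<beta>[OF x(1)] by (simp add: algebra_simps)
    \<comment> \<open>\<open>M \<ge> 20 * F\<close> bounds the right-hand side by
      \<open>3 / 5 * M\<close>, which is below \<open>2 / 3 * M\<close>.\<close>
    then show False using x(2) M(1) F by linarith
  qed
  define k :: real where "k = of_int (round (c $ i))"
  \<comment> \<open>The shift along \<open>v\<close> that makes the height integral; rounding and
    \<open>v $ i > 1\<close> keep \<open>2 * t\<close> within the range of symmetric
    scaling.\<close>
  define t where "t = (k - c $ i) / v $ i"
  have "\<bar>k - c $ i\<bar> \<le> 1 / 2" unfolding k_def by (rule of_int_round_abs_le)
  then have "\<bar>t\<bar> \<le> 1 / 2" unfolding t_def abs_divide using v1 by (auto simp: divide_le_eq)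
  then have u: "2 *\<^sub>R (t *\<^sub>R v) \<in> C" using scale[OF v(1), of "2 * t"] by simp
  define c' where "c' = c + t *\<^sub>R v - axis i k"
  have "c' $ i = 0" using v1 by (simp add: c'_def t_def)
  moreover have "c' \<in> coord_space (insert i S)"
    unfolding c'_def using c v(1) C(1) by (auto intro!: coord_space_intros)
  ultimately have c': "c' \<in> coord_space S" by (auto simp: coord_space_def)
  have "\<exists>z\<in>int_lattice. z - c' \<in> D"
  proof (rule symmetric_flatD[OF IH _ _ _ _ _ c' big_slice])
    show "D \<subseteq> coord_space S" using D_C C(1) by (force simp: D_def coord_space_def)
    show "bounded D" using D_C C(3) by (meson bounded_subset subsetI)
    show "D \<noteq> {}" using zeroC by (auto simp: D_def intro!: exI[of _ 0])
    show "convex D"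
      unfolding Dvim
      by (intro convex_Int convex_linear_vimage lin2 C(2)) (auto simp: convex_def)
    show "- x \<in> D" if "x \<in> D" for x using that sym by (force simp: D_def)
  qed
  then obtain z where z: "z \<in> int_lattice" "2 *\<^sub>R (z - c') \<in> C" by (auto simp: D_def)
  have "(1 / 2) *\<^sub>R (2 *\<^sub>R (z - c')) + (1 / 2) *\<^sub>R (2 *\<^sub>R (t *\<^sub>R v)) \<in> C"
    using z(2) u by (intro convexD[OF C(2)]) auto
  then have "(z + axis i k) - c \<in> C" by (simp add: c'_def algebra_simps)
  moreover have "z + axis i k \<in> int_lattice"
    using z(1) by (intro int_lattice_add axis_in_int_lattice) (auto simp: k_def)
  ultimately show ?thesis by blast
qed

text \<open>Brings \<open>C\<close> into the position of the preceding step: a functional of almost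
  minimal width becomes, up to an integer factor, a coordinate.\<close>

lemma symmetric_flatness:
  fixes S :: "'n::finite set"
  shows "\<exists>F\<ge>1. symmetric_flat S F"
  using finite[of S]
proof (induction S rule: finite_induct)
  case empty
  show ?case
    unfolding symmetric_flat_def
    by (intro exI[of _ 1] conjI order_refl allI impI bexI[of _ 0] zero_in_int_lattice)
       (auto simp: coord_space_empty subset_singleton_iff)
next
  case (insert i S)
  let ?V = "coord_space (insert i S)"
  obtain F where F: "F \<ge> 1" and IH: "symmetric_flat S F"
    using insert.IH by blast
  have "\<exists>z\<in>int_lattice. z - c \<in> C"
    if C: "C \<subseteq> ?V" "convex C" "bounded C" "C \<noteq> {}" and sym: "\<And>x. x \<in> C \<Longrightarrow> - x \<in> C"
      and c: "c \<in> ?V" and big: "\<And>\<phi>. int_functional (insert i S) \<phi> \<Longrightarrow> \<exists>x\<in>C. \<phi> x > 16 * F" for C c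
  proof -
    define \<M> where "\<M> = {M. \<exists>\<phi>. int_functional (insert i S) \<phi> \<and> (\<forall>x\<in>C. \<phi> x \<le> M)}"
    obtain K where K: "\<And>x. x \<in> C \<Longrightarrow> norm x \<le> K" using C(3) by (auto simp: bounded_iff)
    have "x $ i \<le> K" if "x \<in> C" for x
      using K[OF that] component_le_norm_cart[of x i] by linarith
    then have "K \<in> \<M>"
      unfolding \<M>_def using int_functional_nth[of i "insert i S"] by blast
    have lower: "16 * F \<le> M" if "M \<in> \<M>" for M
      using that big unfolding \<M>_def by force
    define m where "m = Inf \<M>"
    have m: "m \<ge> 16 * F" unfolding m_def using \<open>K \<in> \<M>\<close> lower by (intro cInf_greatest) auto
    \<comment> \<open>The slack 5/4 serves twice: \<open>5 / 4 * (16 * F) = 20 * F\<close> meets the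
      lower bound on \<open>M\<close> in the step, and \<open>2 / 3 * (5 / 4) = 5 / 6\<close> is
      below 1, so that no functional can be bounded by \<open>5 / 6 * m\<close> on
      \<open>C\<close>.\<close>
    have "Inf \<M> < 5 / 4 * m" using m F by (simp add: m_def)
    then obtain M where M: "M \<in> \<M>" "M < 5 / 4 * m"
      using \<open>K \<in> \<M>\<close> cInf_lessD[of \<M> "5 / 4 * m"] by blast
    then obtain \<phi> where \<phi>: "int_functional (insert i S) \<phi>" "\<And>x. x \<in> C \<Longrightarrow> \<phi> x \<le> M"
      unfolding \<M>_def by blast
    obtain f g where f: "lattice_aut (insert i S) f" and g: "g \<in> \<int>" "\<And>x. x \<in> ?V \<Longrightarrow> \<phi> (f x) = g * x $ i"
      using int_functional_normal_form[of i "insert i S" \<phi>] \<phi>(1) by (auto simp: int_functional_def)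
    have lin: "linear f" "bij f" using f by (auto simp: lattice_aut_def)
    have inv: "lattice_aut (insert i S) (inv f)" using f by (rule lattice_aut_inv)
    obtain x0 where "x0 \<in> ?V" "\<phi> (f x0) \<noteq> 0"
      using int_functional_comp[OF f \<phi>(1)] by (auto simp: int_functional_def)
    then have g1: "\<bar>g\<bar> \<ge> 1" using g by (auto elim!: Ints_cases)
    define C' where "C' = f -` C"
    have C'_inv: "C' = inv f ` C" unfolding C'_def using lin(2) by (rule bij_vimage_eq_inv_image)
    have C'V: "C' \<subseteq> ?V" unfolding C'_inv using C(1) by (auto intro!: lattice_aut_coord_space[OF inv])
    have "\<exists>z\<in>int_lattice. z - inv f c \<in> C'"
    proof (rule symmetric_flatness_step[OF \<open>i \<notin> S\<close> F IH C'V, where M = "5 / 4 * m"])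
      show "convex C'" unfolding C'_def using lin C by (intro convex_linear_vimage)
      show "bounded C'"
        unfolding C'_inv using inv C(3)
        by (intro bounded_linear_image) (auto simp: lattice_aut_def linear_conv_bounded_linear)
      show "- x \<in> C'" if "x \<in> C'" for x
        using that sym lin(1) by (simp add: C'_def linear_neg)
      show "inv f c \<in> ?V" using inv c by (rule lattice_aut_coord_space)
      show "20 * F \<le> 5 / 4 * m" using m by simp
      show "\<bar>x $ i\<bar> \<le> 5 / 4 * m" if x: "x \<in> C'" for x
      proof -
        have "f x \<in> C" "- f x \<in> C" "x \<in> ?V" using x sym C'V by (auto simp: C'_def)
        moreover have "\<phi> (- f x) = - \<phi> (f x)"
          using \<phi>(1) by (simp add: int_functional_def linear_neg)
        ultimately have "\<bar>g * x $ i\<bar> \<le> M" using \<phi>(2)[of "f x"] \<phi>(2)[of "- f x"] g(2)[of x] by auto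
        moreover have "1 * \<bar>x $ i\<bar> \<le> \<bar>g\<bar> * \<bar>x $ i\<bar>" using g1 by (intro mult_right_mono) auto
        ultimately show ?thesis using M by (simp add: abs_mult)
      qed
      show "\<exists>x\<in>C'. \<psi> x > 2 / 3 * (5 / 4 * m)" if \<psi>: "int_functional (insert i S) \<psi>" for \<psi>
      proof (rule ccontr)
        assume "\<not> ?thesis"
        then have "\<psi> (inv f x) \<le> 5 / 6 * m" if "x \<in> C" for x
          using that by (auto simp: C'_inv not_less)
        then have "5 / 6 * m \<in> \<M>"
          unfolding \<M>_def using int_functional_comp[OF inv \<psi>] by blast
        then have "m \<le> 5 / 6 * m"
          unfolding m_def using lower by (intro cInf_lower bdd_belowI) auto
        then show False using m F by simp
      qed
    qed
    then obtain z where z: "z \<in> int_lattice" "f (z - inv f c) \<in> C" by (auto simp: C'_def)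
    then have "f z - c \<in> C" using lin(1) by (simp add: linear_diff lattice_aut_inv_cancel[OF f])
    moreover have "f z \<in> int_lattice" using f z(1) by (rule lattice_aut_int_lattice)
    ultimately show ?thesis by blast
  qed
  then show ?case using F by (intro exI[of _ "16 * F"]) (auto simp: symmetric_flat_def)
qed

section \<open>From symmetric sets to compact convex sets\<close>

lemma convex_padded_mean:
  assumes K: "convex K" and A: "A \<subseteq> K" "finite A" "card A \<le> n" and "x0 \<in> K" "n > 0"
  shows "(1 / real n) *\<^sub>R (\<Sum>A + real (n - card A) *\<^sub>R x0) \<in> K"
proof (cases "A = {}")
  case True
  then show ?thesis using assms by simp
next
  case False
  define a where "a = real (card A)"
  have a: "a > 0" using False A by (simp add: a_def card_gt_0_iff)
  have "(\<Sum>x\<in>A. (1 / a) *\<^sub>R x) \<in> K"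
    using A a by (intro convex_sum[OF _ K]) (auto simp: a_def)
  then have "(a / n) *\<^sub>R (\<Sum>x\<in>A. (1 / a) *\<^sub>R x) + (real (n - card A) / n) *\<^sub>R x0 \<in> K"
    using assms a by (intro convexD[OF K]) (auto simp: a_def of_nat_diff field_simps)
  also have "(a / n) *\<^sub>R (\<Sum>x\<in>A. (1 / a) *\<^sub>R x) = (1 / n) *\<^sub>R \<Sum>A"
    using a by (simp flip: scaleR_sum_right)
  finally show ?thesis by (simp add: scaleR_add_right)
qed

text \<open>By Helly's theorem, the copies of \<open>K\<close> shrunk by the factor \<open>n / (n + 1)\<close> towards the points
  of \<open>K\<close> have a common point: any \<open>n + 1\<close> of them share the (padded) mean of their centres.\<close>

lemma Minkowski_center:
  fixes K :: "'a::euclidean_space set"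
  assumes K: "compact K" "convex K" "K \<noteq> {}"
  obtains c where "\<And>x. x \<in> K \<Longrightarrow> c + (1 / DIM('a)) *\<^sub>R (c - x) \<in> K"
proof -
  define n where "n = DIM('a)"
  have n: "n > 0" by (simp add: n_def)
  define g where "g x = (\<lambda>y. (1 / real (n + 1)) *\<^sub>R (real n *\<^sub>R y + x)) ` K" for x
  have comp: "compact (g x)" for x
    unfolding g_def by (intro compact_continuous_image continuous_intros K)
  have conv: "convex (g x)" for x
  proof -
    have "g x = (\<lambda>y. (1 / real (n + 1)) *\<^sub>R x + y) ` (\<lambda>y. (real n / real (n + 1)) *\<^sub>R y) ` K"
      unfolding g_def image_image by (intro image_cong) (auto simp: scaleR_add_right)
    then show ?thesis using K by (simp add: convex_scaling convex_translation)
  qed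
  have small: "(\<Inter>x\<in>T. g x) \<noteq> {}" if T: "T \<subseteq> K" "finite T" "card T \<le> n + 1" for T
  proof -
    obtain x0 where x0: "x0 \<in> K" using K by blast
    define c where "c = (1 / real (n + 1)) *\<^sub>R (\<Sum>T + real (n + 1 - card T) *\<^sub>R x0)"
    have "c \<in> g x" if x: "x \<in> T" for x
    proof -
      let ?y = "(1 / real n) *\<^sub>R (\<Sum>(T - {x}) + real (n - card (T - {x})) *\<^sub>R x0)"
      have "card (T - {x}) \<le> n" using T x by (simp add: card_Diff_singleton)
      then have "?y \<in> K"
        using T x0 n by (intro convex_padded_mean[OF K(2)]) auto
      moreover have "card T > 0" using x T by (auto simp: card_gt_0_iff)
      then have "n - card (T - {x}) = n + 1 - card T"
        using x T by (simp add: card_Diff_singleton)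
      then have "real n *\<^sub>R ?y + x = \<Sum>T + real (n + 1 - card T) *\<^sub>R x0"
        using n x T by (simp add: sum.remove[of T x])
      then have "c = (1 / real (n + 1)) *\<^sub>R (real n *\<^sub>R ?y + x)"
        unfolding c_def by simp
      ultimately show ?thesis unfolding g_def by blast
    qed
    then show ?thesis by blast
  qed
  \<comment> \<open>Helly's theorem counts distinct sets, while different centres might give the
    same copy; passing to a subset \<open>U\<close> on which \<open>g\<close> is injective matches
    the counts.\<close>
  have fin: "(\<Inter>x\<in>T. g x) \<noteq> {}" if T: "T \<subseteq> K" "finite T" for T
  proof (cases "card (g ` T) \<le> n + 1")
    case True
    obtain U where U: "U \<subseteq> T" "inj_on g U" "g ` T = g ` U"
      using subset_image_inj[THEN iffD1, OF order_refl[of "g ` T"]] by auto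
    then have "card U \<le> n + 1" using True by (simp add: card_image)
    moreover have "finite U" using U(1) T(2) finite_subset by blast
    ultimately show ?thesis using small[of U] U T by auto
  next
    case False
    show ?thesis
    proof (rule Helly)
      show "DIM('a) + 1 \<le> card (g ` T)" using False by (simp add: n_def)
      show "\<forall>s\<in>g ` T. convex s" using conv by auto
      fix t assume t: "t \<subseteq> g ` T" "card t = DIM('a) + 1"
      then obtain U where U: "U \<subseteq> T" "inj_on g U" "t = g ` U"
        using subset_image_inj[THEN iffD1, OF t(1)] by auto
      then have "card U = n + 1" using t(2) by (simp add: card_image n_def)
      moreover have "finite U" using U(1) T(2) finite_subset by blast
      ultimately show "\<Inter>t \<noteq> {}" using small[of U] U T by auto
    qed
  qed
  obtain x0 where x0: "x0 \<in> K" using K by blast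
  \<comment> \<open>The finite intersection property extends this to all centres at once, with
    \<open>g x0\<close> as the compact member.\<close>
  have "g x0 \<inter> (\<Inter>x\<in>K. g x) \<noteq> {}"
  proof (rule compact_imp_fip_image[OF comp])
    show "closed (g x)" for x using comp by (rule compact_imp_closed)
    show "g x0 \<inter> (\<Inter>x\<in>T. g x) \<noteq> {}" if "finite T" "T \<subseteq> K" for T
      using fin[of "insert x0 T"] that x0 by auto
  qed
  then obtain c where c: "\<And>x. x \<in> K \<Longrightarrow> c \<in> g x" by blast
  show thesis
  proof (rule that[of c])
    fix x assume "x \<in> K"
    then obtain y where y: "y \<in> K" "c = (1 / real (n + 1)) *\<^sub>R (real n *\<^sub>R y + x)"
      using c[of x] by (auto simp: g_def)
    then have c': "real (n + 1) *\<^sub>R c = real n *\<^sub>R y + x" by simp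
    have "real n *\<^sub>R (c + (1 / real n) *\<^sub>R (c - x)) = real (n + 1) *\<^sub>R c - x"
      using n by (simp add: algebra_simps)
    also have "\<dots> = real n *\<^sub>R y" unfolding c' by simp
    finally have "c + (1 / real n) *\<^sub>R (c - x) = y" using n by simp
    then show "c + (1 / DIM('a)) *\<^sub>R (c - x) \<in> K" using y(1) by (simp add: n_def)
  qed
qed

text \<open>With the Minkowski centre \<open>c\<close>, the symmetric set of all \<open>d\<close>
  such that \<open>c + d\<close> and \<open>c - d\<close> lie in \<open>K\<close> contains
  \<open>K - c\<close> scaled by \<open>1 / n\<close>; so its half-width bound \<open>F\<close>
  gives width at most \<open>2 * n * F\<close> for \<open>K\<close>.\<close>

lemma flatness_compact:
  fixes S :: "'n::finite set"
  shows "\<exists>F\<ge>1. \<forall>K \<subseteq> coord_space S. compact K \<longrightarrow> convex K \<longrightarrow> K \<noteq> {} \<longrightarrow> K \<inter> int_lattice = {} \<longrightarrow>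
      (\<exists>\<phi>. int_functional S \<phi> \<and> (\<forall>x\<in>K. \<forall>y\<in>K. \<phi> x - \<phi> y \<le> F))"
proof -
  obtain F where F: "F \<ge> 1" "symmetric_flat S F" using symmetric_flatness by blast
  define n where "n = real DIM(real ^ 'n)"
  have "DIM(real ^ 'n) \<ge> 1" by (rule DIM_ge_Suc0[unfolded One_nat_def[symmetric]])
  then have n: "n \<ge> 1" unfolding n_def by linarith
  have "\<exists>\<phi>. int_functional S \<phi> \<and> (\<forall>x\<in>K. \<forall>y\<in>K. \<phi> x - \<phi> y \<le> 2 * n * F)"
    if KV: "K \<subseteq> coord_space S" and K: "compact K" "convex K" "K \<noteq> {}" and free: "K \<inter> int_lattice = {}" for K
  proof -
    obtain c where c: "\<And>x. x \<in> K \<Longrightarrow> c + (1 / n) *\<^sub>R (c - x) \<in> K"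
      using Minkowski_center[OF K] unfolding n_def by blast
    define C where "C = {d. c + d \<in> K \<and> c - d \<in> K}"
    have shrink: "c + (1 / n) *\<^sub>R (x - c) \<in> K" if cK: "c \<in> K" and "x \<in> K" for x
    proof -
      have "(1 - 1 / n) *\<^sub>R c + (1 / n) *\<^sub>R x \<in> K"
        using cK that n by (intro convexD[OF K(2)]) auto
      then show ?thesis by (simp add: algebra_simps)
    qed
    obtain x0 where x0: "x0 \<in> K" using K by blast
    \<comment> \<open>With these weights \<open>c\<close> lies on the segment from \<open>x0\<close>
      to its image opposite \<open>c\<close>, hence in \<open>K\<close>.\<close>
    have "(1 / (n + 1)) *\<^sub>R x0 + (n / (n + 1)) *\<^sub>R (c + (1 / n) *\<^sub>R (c - x0)) \<in> K"
      using n x0 c[OF x0] by (intro convexD[OF K(2)]) (auto simp: field_simps)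
    also have "(1 / (n + 1)) *\<^sub>R x0 + (n / (n + 1)) *\<^sub>R (c + (1 / n) *\<^sub>R (c - x0)) =
        (n / (n + 1) + 1 / (n + 1)) *\<^sub>R c"
      using n by (simp add: scaleR_add_right scaleR_diff_right scaleR_add_left)
    also have "n / (n + 1) + 1 / (n + 1) = 1" using n by (simp add: field_simps)
    finally have cK: "c \<in> K" by simp
    have "\<not> (\<exists>z\<in>int_lattice. z - c \<in> C)" using free by (auto simp: C_def)
    moreover have "\<exists>z\<in>int_lattice. z - c \<in> C" if "\<And>\<phi>. int_functional S \<phi> \<Longrightarrow> \<exists>x\<in>C. \<phi> x > F"
    proof (rule symmetric_flatD[OF F(2) _ _ _ _ _ _ that])
      show "C \<subseteq> coord_space S"
      proof
        fix d assume "d \<in> C"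
        then have "(c + d) - c \<in> coord_space S"
          using cK KV by (intro coord_space_diff) (auto simp: C_def)
        then show "d \<in> coord_space S" by simp
      qed
      show "convex C"
      proof (rule convexI)
        fix x y and u v :: real
        assume xy: "x \<in> C" "y \<in> C" and uv: "0 \<le> u" "0 \<le> v" "u + v = 1"
        have "u *\<^sub>R (c + x) + v *\<^sub>R (c + y) \<in> K" "u *\<^sub>R (c - x) + v *\<^sub>R (c - y) \<in> K"
          using xy uv by (auto simp: C_def intro!: convexD[OF K(2)])
        moreover have "u *\<^sub>R c + v *\<^sub>R c = c" using uv by (simp flip: scaleR_add_left)
        then have "u *\<^sub>R (c + x) + v *\<^sub>R (c + y) = c + (u *\<^sub>R x + v *\<^sub>R y)"
          "u *\<^sub>R (c - x) + v *\<^sub>R (c - y) = c - (u *\<^sub>R x + v *\<^sub>R y)"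
          by (simp_all add: algebra_simps)
        ultimately show "u *\<^sub>R x + v *\<^sub>R y \<in> C" by (simp add: C_def)
      qed
      have "bounded ((\<lambda>x. x - c) ` K)"
        using K(1) by (intro bounded_translation_minus compact_imp_bounded)
      moreover have "C \<subseteq> (\<lambda>x. x - c) ` K" by (force simp: C_def)
      ultimately show "bounded C" by (rule bounded_subset)
      show "C \<noteq> {}" using cK by (auto simp: C_def intro!: exI[of _ 0])
      show "- x \<in> C" if "x \<in> C" for x using that by (simp add: C_def)
      show "c \<in> coord_space S" using cK KV by blast
    qed
    ultimately obtain \<phi> where \<phi>: "int_functional S \<phi>" "\<And>d. d \<in> C \<Longrightarrow> \<phi> d \<le> F"
      by (meson not_less)
    have lin: "linear \<phi>" using \<phi> by (simp add: int_functional_def)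
    have *: "\<bar>\<phi> (x - c)\<bar> \<le> n * F" if "x \<in> K" for x
    proof -
      have "(1 / n) *\<^sub>R (x - c) \<in> C" "(1 / n) *\<^sub>R (c - x) \<in> C"
        using shrink[OF cK that] c[OF that] by (auto simp: C_def algebra_simps)
      from this[THEN \<phi>(2)] show ?thesis
        using n by (simp add: linear_cmul[OF lin] linear_diff[OF lin] abs_le_iff field_simps)
    qed
    have "\<phi> x - \<phi> y \<le> 2 * n * F" if "x \<in> K" "y \<in> K" for x y
      using *[OF that(1)] *[OF that(2)] by (simp add: linear_diff[OF lin] abs_le_iff)
    then show ?thesis using \<phi>(1) by blast
  qed
  moreover have "2 * n * F \<ge> 1"
    using n F mult_mono[of 1 n 1 F] by simp
  ultimately show ?thesis by blast
qed

section \<open>Flatness for unbounded sets\<close>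

lemma finite_bounded_int_lattice:
  "finite {y :: real ^ 'n. y \<in> int_lattice \<and> (\<forall>j. \<bar>y $ j\<bar> \<le> a)}"
proof -
  have "vec_nth ` {y :: real ^ 'n. y \<in> int_lattice \<and> (\<forall>j. \<bar>y $ j\<bar> \<le> a)} \<subseteq> PiE UNIV (\<lambda>_. {k \<in> \<int>. \<bar>k\<bar> \<le> a})"
    by (auto simp: int_lattice_def)
  moreover have "finite (PiE (UNIV :: 'n set) (\<lambda>_. {k :: real. k \<in> \<int> \<and> \<bar>k\<bar> \<le> a}))"
    by (intro finite_PiE finite_abs_int_segment) auto
  ultimately have "finite (vec_nth ` {y :: real ^ 'n. y \<in> int_lattice \<and> (\<forall>j. \<bar>y $ j\<bar> \<le> a)})"
    by (rule finite_subset)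
  then show ?thesis by (rule finite_imageD) (auto simp: inj_on_def vec_nth_inject)
qed

text \<open>For unbounded \<open>K\<close>: on a bounded part containing the ball around \<open>p\<close> only finitely many integer
  functionals are bounded by \<open>F\<close>, so one of them works for every bounded part.\<close>

lemma flatness:
  fixes S :: "'n::finite set"
  shows "\<exists>F\<ge>1. \<forall>K \<subseteq> coord_space S. closed K \<longrightarrow> convex K \<longrightarrow> K \<inter> int_lattice = {} \<longrightarrow>
      (\<exists>p\<in>coord_space S. \<exists>r>0. \<forall>x\<in>coord_space S. norm (x - p) < r \<longrightarrow> x \<in> K) \<longrightarrow>
      (\<exists>\<phi>. int_functional S \<phi> \<and> (\<forall>x\<in>K. \<forall>y\<in>K. \<phi> x - \<phi> y \<le> F))"
proof -
  obtain F where F: "F \<ge> 1" and flat: "\<And>K. K \<subseteq> coord_space S \<Longrightarrow> compact K \<Longrightarrow> convex K \<Longrightarrow> K \<noteq> {} \<Longrightarrow>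
      K \<inter> int_lattice = {} \<Longrightarrow> \<exists>\<phi>. int_functional S \<phi> \<and> (\<forall>x\<in>K. \<forall>y\<in>K. \<phi> x - \<phi> y \<le> F)"
    using flatness_compact[of S] by metis
  have "\<exists>\<phi>. int_functional S \<phi> \<and> (\<forall>x\<in>K. \<forall>y\<in>K. \<phi> x - \<phi> y \<le> F)"
    if KV: "K \<subseteq> coord_space S" and K: "closed K" "convex K" "K \<inter> int_lattice = {}"
      and p: "p \<in> coord_space S" and r: "r > 0" and ball: "\<And>x. x \<in> coord_space S \<Longrightarrow> norm (x - p) < r \<Longrightarrow> x \<in> K"
    for K p r
  proof (rule ccontr)
    assume neg: "\<not> ?thesis"
    \<comment> \<open>The candidate coefficient vectors: the ball of radius \<open>r\<close> around
      \<open>p\<close> forces a functional of width at most \<open>F\<close> to have coefficients of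
      size at most \<open>F / r\<close>.\<close>
    let ?Y = "{y :: real ^ 'n. y \<in> int_lattice \<and> (\<forall>j. \<bar>y $ j\<bar> \<le> F / r)}"
    have "\<exists>R. \<forall>y\<in>?Y. int_functional S ((\<bullet>) y) \<longrightarrow>
        (\<exists>u\<in>K \<inter> cball p R. \<exists>v\<in>K \<inter> cball p R. y \<bullet> u - y \<bullet> v > F)"
    proof -
      have "\<exists>R. int_functional S ((\<bullet>) y) \<longrightarrow>
        (\<exists>u\<in>K \<inter> cball p R. \<exists>v\<in>K \<inter> cball p R. y \<bullet> u - y \<bullet> v > F)" for y
      proof (cases "int_functional S ((\<bullet>) y)")
        case True
        then obtain u v where "u \<in> K" "v \<in> K" "y \<bullet> u - y \<bullet> v > F" using neg by (auto simp: not_le)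
        moreover have "u \<in> cball p (max (dist p u) (dist p v))" "v \<in> cball p (max (dist p u) (dist p v))"
          by auto
        ultimately show ?thesis by blast
      qed auto
      then obtain R where R: "\<And>y. int_functional S ((\<bullet>) y) \<Longrightarrow>
        \<exists>u\<in>K \<inter> cball p (R y). \<exists>v\<in>K \<inter> cball p (R y). y \<bullet> u - y \<bullet> v > F"
        by metis
      have "R y \<le> Max (R ` ?Y)" if "y \<in> ?Y" for y
        using that finite_bounded_int_lattice by (intro Max_ge) auto
      then have sub: "cball p (R y) \<subseteq> cball p (Max (R ` ?Y))" if "y \<in> ?Y" for y
        using that by (intro subset_cball) auto
      show ?thesis
      proof (intro exI[of _ "Max (R ` ?Y)"] ballI impI)
        fix y assume y: "y \<in> ?Y" "int_functional S ((\<bullet>) y)"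
        show "\<exists>u\<in>K \<inter> cball p (Max (R ` ?Y)). \<exists>v\<in>K \<inter> cball p (Max (R ` ?Y)). y \<bullet> u - y \<bullet> v > F"
          using R[OF y(2)] sub[OF y(1)] by blast
      qed
    qed
    then obtain R where R: "\<And>y. y \<in> ?Y \<Longrightarrow> int_functional S ((\<bullet>) y) \<Longrightarrow>
        \<exists>u\<in>K \<inter> cball p R. \<exists>v\<in>K \<inter> cball p R. y \<bullet> u - y \<bullet> v > F" by blast
    \<comment> \<open>Radius \<open>R\<close> retains a pair of width above \<open>F\<close> for
      every candidate, radius \<open>r\<close> the ball needed for the coefficient bound.\<close>
    define K' where "K' = K \<inter> cball p (max R r)"
    have "p \<in> K'" using ball[OF p] r by (simp add: K'_def)
    moreover have "compact K'" unfolding K'_def using K(1) by (intro closed_Int_compact) auto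
    moreover have "convex K'" unfolding K'_def using K(2) by (intro convex_Int) auto
    moreover have "K' \<subseteq> coord_space S" "K' \<inter> int_lattice = {}"
      using KV K(3) by (auto simp: K'_def)
    ultimately have "\<exists>\<phi>. int_functional S \<phi> \<and> (\<forall>x\<in>K'. \<forall>y\<in>K'. \<phi> x - \<phi> y \<le> F)"
      by (intro flat) auto
    then obtain \<phi> where \<phi>: "int_functional S \<phi>" "\<And>x y. x \<in> K' \<Longrightarrow> y \<in> K' \<Longrightarrow> \<phi> x - \<phi> y \<le> F"
      by blast
    have lin: "linear \<phi>" using \<phi> by (simp add: int_functional_def)
    define y where "y = (\<chi> j. if j \<in> S then \<phi> (axis j 1) else 0)"
    have y\<phi>: "y \<bullet> x = \<phi> x" if "x \<in> coord_space S" for x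
      unfolding linear_functional_expand[OF lin, of x] inner_vec_def
      using that by (intro sum.cong) (auto simp: y_def coord_space_def)
    have "\<phi> (axis j 1) \<in> \<int>" for j
      using \<phi>(1) axis_in_int_lattice[of 1 j] by (simp add: int_functional_def)
    then have yZ: "y \<in> int_lattice" by (simp add: y_def int_lattice_def)
    have "\<bar>y $ j\<bar> \<le> F / r" for j
    proof (cases "j \<in> S")
      case True
      define d :: "real ^ 'n" where "d = axis j (r / 2)"
      have d: "d \<in> coord_space S" "norm d = r / 2"
        using True r by (simp_all add: d_def axis_in_coord_space) (simp add: axis_eq_scaleR[of j "r / 2"])
      have "p + d \<in> K'" "p - d \<in> K'"
        using ball[of "p + d"] ball[of "p - d"] p d r
        by (auto simp: K'_def dist_norm le_max_iff_disj intro: coord_space_intros)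
      then have "\<bar>\<phi> (p + d) - \<phi> (p - d)\<bar> \<le> F" using \<phi>(2)[of "p + d" "p - d"] \<phi>(2)[of "p - d" "p + d"] by auto
      moreover have "\<phi> (p + d) - \<phi> (p - d) = 2 * \<phi> d"
        by (simp add: linear_add[OF lin] linear_diff[OF lin])
      moreover have "\<phi> d = r / 2 * \<phi> (axis j 1)"
        unfolding d_def axis_eq_scaleR[of j "r / 2"] by (simp add: linear_cmul[OF lin])
      ultimately have "\<bar>r * \<phi> (axis j 1)\<bar> \<le> F" by simp
      then show ?thesis using r True by (simp add: y_def abs_mult field_simps)
    qed (use F r in \<open>auto simp: y_def\<close>)
    then have Y: "y \<in> ?Y" using yZ by blast
    have "int_functional S ((\<bullet>) y)"
      using \<phi>(1) yZ y\<phi>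
      by (auto simp: int_functional_def inner_vec_def int_lattice_def
          intro!: Ints_sum Ints_mult linear_compose_sum bounded_linear.linear[OF bounded_linear_inner_right])
    from R[OF Y this] obtain u v where uv: "u \<in> K \<inter> cball p R" "v \<in> K \<inter> cball p R" "y \<bullet> u - y \<bullet> v > F"
      by blast
    then have "u \<in> K'" "v \<in> K'" "u \<in> coord_space S" "v \<in> coord_space S" using KV by (auto simp: K'_def)
    then show False using uv(3) \<phi>(2)[of u v] y\<phi> by simp
  qed
  then show ?thesis using F by (intro exI[of _ F]) blast
qed

section \<open>Simplices inscribed in generalized cross-polyhedra\<close>

text \<open>The functionals \<open>l j\<close> are the facet normals of a simplex (times a linear space): up to scaling
  \<open>w\<close> is their only linear dependency on \<open>coord_space S\<close>.\<close>

definition simplex_family ::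
    "'n::finite set \<Rightarrow> nat \<Rightarrow> (nat \<Rightarrow> real ^ 'n \<Rightarrow> real) \<Rightarrow> (nat \<Rightarrow> real) \<Rightarrow> bool" where
  "simplex_family S k l w \<longleftrightarrow> 0 < k \<and> (\<forall>j<k. linear (l j) \<and> 0 < w j) \<and>
     (\<forall>x\<in>coord_space S. (\<Sum>j<k. w j * l j x) = 0) \<and>
     (\<forall>v. (\<Sum>j<k. w j * v j) = 0 \<longrightarrow> (\<exists>q\<in>coord_space S. \<forall>j<k. l j q = v j))"

text \<open>The strictness later keeps points off the apex of a cone, where the projection from the
  apex to the slice breaks down.\<close>

definition open_simplex ::
    "'n::finite set \<Rightarrow> nat \<Rightarrow> (nat \<Rightarrow> real ^ 'n \<Rightarrow> real) \<Rightarrow> real ^ 'n \<Rightarrow> (real ^ 'n) set" where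
  "open_simplex S k l p = {x \<in> coord_space S. \<forall>j<k. l j (x - p) < 1}"

text \<open>For \<open>K\<close> inside \<open>coord_space S\<close>, the last condition says that
  shrinking \<open>K\<close> towards \<open>p\<close> by \<open>\<alpha>\<close> moves it into the
  simplex, hence into \<open>G\<close>. Keeping a simplex in between is what allows the lift by one
  dimension.\<close>

definition approximable :: "'n::finite set \<Rightarrow> real ^ 'n \<Rightarrow> (real ^ 'n) set \<Rightarrow> real \<Rightarrow> bool" where
  "approximable S p K \<alpha> \<longleftrightarrow> (\<exists>G\<in>cross_sets S. \<exists>k l w. simplex_family S k l w \<and>
     open_simplex S k l p \<subseteq> G \<and> (\<forall>x\<in>K. \<forall>j<k. \<alpha> * l j (x - p) < 1))"

lemma approximableI:
  assumes "G \<in> cross_sets S" "simplex_family S k l w" "open_simplex S k l p \<subseteq> G"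
    and "\<And>x j. x \<in> K \<Longrightarrow> j < k \<Longrightarrow> \<alpha> * l j (x - p) < 1"
  shows "approximable S p K \<alpha>"
  unfolding approximable_def using assms by blast

section \<open>Invariance of approximability under lattice symmetries\<close>

lemma approximable_mono:
  assumes "approximable S p K \<alpha>" "0 \<le> \<beta>" "\<beta> \<le> \<alpha>"
  shows "approximable S p K \<beta>"
proof -
  obtain G k l w where G: "G \<in> cross_sets S" "simplex_family S k l w" "open_simplex S k l p \<subseteq> G"
    and K: "\<And>x j. x \<in> K \<Longrightarrow> j < k \<Longrightarrow> \<alpha> * l j (x - p) < 1"
    using assms(1) unfolding approximable_def by blast
  have "\<beta> * l j (x - p) < 1" if "x \<in> K" "j < k" for x j
  proof (cases "l j (x - p) \<le> 0")
    case True
    then have "\<beta> * l j (x - p) \<le> 0" using assms(2) by (rule mult_nonneg_nonpos[rotated])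
    then show ?thesis by linarith
  next
    case False
    then have "\<beta> * l j (x - p) \<le> \<alpha> * l j (x - p)" using assms(3) by (intro mult_right_mono) auto
    then show ?thesis using K[OF that] by linarith
  qed
  then show ?thesis by (intro approximableI[OF G])
qed

lemma approximable_aut:
  assumes "approximable S p K \<alpha>" and f: "lattice_aut S f"
  shows "approximable S (f p) (f ` K) \<alpha>"
proof -
  obtain G k l w where G: "G \<in> cross_sets S" and fam: "simplex_family S k l w"
    and sub: "open_simplex S k l p \<subseteq> G"
    and K: "\<And>x j. x \<in> K \<Longrightarrow> j < k \<Longrightarrow> \<alpha> * l j (x - p) < 1"
    using assms(1) unfolding approximable_def by blast
  have inv: "lattice_aut S (inv f)" using f by (rule lattice_aut_inv)
  have lin: "linear (inv f)" using inv by (rule lattice_aut_linear)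
  note cancel = lattice_aut_inv_cancel[OF f]
  let ?l = "\<lambda>j x. l j (inv f x)"
  show ?thesis
  proof (rule approximableI)
    show "f ` G \<in> cross_sets S" using G f by (rule cross_sets_aut)
    have "linear (?l j)" if "j < k" for j
      using linear_compose[OF lin, of "l j"] fam that by (simp add: o_def simplex_family_def)
    moreover have "\<exists>q\<in>coord_space S. \<forall>j<k. ?l j q = v j" if "(\<Sum>j<k. w j * v j) = 0" for v
    proof -
      obtain q where "q \<in> coord_space S" "\<forall>j<k. l j q = v j"
        using fam \<open>(\<Sum>j<k. w j * v j) = 0\<close> unfolding simplex_family_def by blast
      then show ?thesis
        using lattice_aut_coord_space[OF f] by (intro bexI[of _ "f q"]) (auto simp: cancel)
    qed
    ultimately show "simplex_family S k ?l w"
      using fam lattice_aut_coord_space[OF inv] by (simp add: simplex_family_def)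
    show "open_simplex S k ?l (f p) \<subseteq> f ` G"
    proof
      fix x assume x: "x \<in> open_simplex S k ?l (f p)"
      then have "inv f x \<in> open_simplex S k l p"
        using lattice_aut_coord_space[OF inv] by (auto simp: open_simplex_def linear_diff[OF lin] cancel)
      then have "inv f x \<in> G" using sub by blast
      then have "f (inv f x) \<in> f ` G" by (rule imageI)
      then show "x \<in> f ` G" by (simp add: cancel)
    qed
    show "\<alpha> * ?l j (x - f p) < 1" if "x \<in> f ` K" "j < k" for x j
      using that K by (auto simp: linear_diff[OF lin] cancel)
  qed
qed

lemma approximable_translate:
  assumes "approximable S p K \<alpha>" and \<tau>: "\<tau> \<in> int_lattice" "\<tau> \<in> coord_space S"
  shows "approximable S (\<tau> + p) ((+) \<tau> ` K) \<alpha>"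
proof -
  obtain G k l w where G: "G \<in> cross_sets S" and fam: "simplex_family S k l w"
    and sub: "open_simplex S k l p \<subseteq> G"
    and K: "\<And>x j. x \<in> K \<Longrightarrow> j < k \<Longrightarrow> \<alpha> * l j (x - p) < 1"
    using assms(1) unfolding approximable_def by blast
  show ?thesis
  proof (rule approximableI[OF cross_sets_translate[OF G \<tau>] fam])
    show "open_simplex S k l (\<tau> + p) \<subseteq> (+) \<tau> ` G"
    proof
      fix x assume x: "x \<in> open_simplex S k l (\<tau> + p)"
      then have "x - \<tau> \<in> open_simplex S k l p"
        using \<tau>(2) by (auto simp: open_simplex_def diff_diff_add intro: coord_space_diff)
      then have "x - \<tau> \<in> G" using sub by blast
      then show "x \<in> (+) \<tau> ` G" by (intro image_eqI[of _ _ "x - \<tau>"]) auto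
    qed
    show "\<alpha> * l j (x - (\<tau> + p)) < 1" if "x \<in> (+) \<tau> ` K" "j < k" for x j
      using that K by auto
  qed
qed

text \<open>A nonintegral coordinate with denominator \<open>s\<close> has distance at least
  \<open>1 / s\<close> from the integers, so the slab of half-width \<open>1 / s\<close> around
  \<open>p\<close> lies in a split; the slab is a one-dimensional simplex times a linear space. The
  2 in the constant makes the final inequality strict.\<close>

lemma approximable_split:
  assumes i: "i \<in> S" and s: "s > 0" "real s * p $ i \<in> \<int>" "p $ i \<notin> \<int>"
    and F: "F > 0" "\<And>x. x \<in> K \<Longrightarrow> \<bar>x $ i - p $ i\<bar> \<le> F"
  shows "approximable S p K (1 / (2 * real s * F))"
proof (rule approximableI)
  let ?f = "of_int \<lfloor>p $ i\<rfloor> :: real"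
  let ?X = "axis i ` {?f .. ?f + 1}"
  let ?l = "\<lambda>j x. if j = 0 then real s * x $ i else - (real s * x $ i)"
  have lin: "linear (?l j)" for j :: nat
    by (intro linearI) (simp_all add: algebra_simps)
  have "(\<lambda>x. x) ` {x + w |x w. x \<in> ?X \<and> w \<in> coord_space (S - {i})} \<in> cross_sets S"
    unfolding cross_sets_def using i lattice_aut_id gen_cross_polytope.base[of i "\<lfloor>p $ i\<rfloor>"] by blast
  then show "{x + w |x w. x \<in> ?X \<and> w \<in> coord_space (S - {i})} \<in> cross_sets S" by simp
  show "simplex_family S 2 ?l (\<lambda>_. 1)"
    unfolding simplex_family_def
  proof (intro conjI allI impI ballI)
    fix v :: "nat \<Rightarrow> real" assume "(\<Sum>j<2. 1 * v j) = 0"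
    then have "v 1 = - v 0" by (simp add: numeral_2_eq_2)
    then show "\<exists>q\<in>coord_space S. \<forall>j<2. ?l j q = v j"
      using s(1) i
      by (intro bexI[of _ "axis i (v 0 / real s)"] axis_in_coord_space) (auto simp: less_2_cases_iff)
  qed (use lin in \<open>auto simp: numeral_2_eq_2\<close>)
  show "open_simplex S 2 ?l p \<subseteq> {x + w |x w. x \<in> ?X \<and> w \<in> coord_space (S - {i})}"
  proof
    fix x assume "x \<in> open_simplex S 2 ?l p"
    then have x: "x \<in> coord_space S" and l: "\<And>j :: nat. j < 2 \<Longrightarrow> ?l j (x - p) < 1"
      unfolding open_simplex_def by blast+
    have lt: "real s * (x $ i - p $ i) < 1" "- (real s * (x $ i - p $ i)) < 1"
      using l[of 0] l[of 1] by simp_all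
    obtain m :: int where m: "real s * p $ i = of_int m" using s(2) by (auto elim: Ints_cases)
    have "p $ i \<noteq> ?f" "p $ i \<noteq> ?f + 1" using s(3) by (metis Ints_of_int, metis Ints_of_int of_int_1 of_int_add)
    then have "?f < p $ i" "p $ i < ?f + 1" by linarith+
    then have "real s * ?f < real s * p $ i" "real s * p $ i < real s * (?f + 1)"
      using s(1) by simp_all
    then have "of_int (int s * \<lfloor>p $ i\<rfloor>) < (of_int m :: real)" "of_int m < (of_int (int s * (\<lfloor>p $ i\<rfloor> + 1)) :: real)"
      by (simp_all add: m)
    then have "int s * \<lfloor>p $ i\<rfloor> + 1 \<le> m" "m + 1 \<le> int s * (\<lfloor>p $ i\<rfloor> + 1)"
      unfolding of_int_less_iff by linarith+
    then have "(of_int (int s * \<lfloor>p $ i\<rfloor> + 1) :: real) \<le> of_int m" "(of_int (m + 1) :: real) \<le> of_int (int s * (\<lfloor>p $ i\<rfloor> + 1))"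
      unfolding of_int_le_iff by auto
    then have "real s * ?f + 1 \<le> real s * p $ i" "real s * p $ i + 1 \<le> real s * (?f + 1)"
      by (simp_all add: m)
    then have "real s * ?f < real s * x $ i" "real s * x $ i < real s * (?f + 1)"
      using lt unfolding right_diff_distrib distrib_left by linarith+
    then have "x $ i \<in> {?f .. ?f + 1}" using s(1) by simp
    moreover have "x - axis i (x $ i) \<in> coord_space (S - {i})"
      using x by (auto simp: coord_space_def axis_def)
    ultimately show "x \<in> {x + w |x w. x \<in> ?X \<and> w \<in> coord_space (S - {i})}"
      by (intro CollectI exI[of _ "axis i (x $ i)"] exI[of _ "x - axis i (x $ i)"]) auto
  qed
  show "1 / (2 * real s * F) * ?l j (x - p) < 1" if "x \<in> K" for x and j :: nat
  proof -
    have "\<bar>?l j (x - p)\<bar> = real s * \<bar>x $ i - p $ i\<bar>" by (simp add: abs_mult)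
    also have "\<dots> \<le> real s * F" using F(2)[OF that] by (intro mult_left_mono) auto
    finally have "?l j (x - p) \<le> real s * F" by linarith
    also have "\<dots> < 2 * real s * F" using s(1) F(1) by simp
    finally show ?thesis using s(1) F(1) by (simp add: field_simps)
  qed
qed

text \<open>A shear moves the prescribed apex \<open>q\<close> at height \<open>- h\<close> over a point of \<open>G\<close>, which exists because
  the lattice translates of \<open>G\<close> cover the space and \<open>h \<le> 1\<close>.\<close>

lemma cross_sets_cone:
  assumes G: "G \<in> cross_sets S" and i: "i \<notin> S" and q: "q \<in> coord_space S" and h: "0 < h" "h \<le> 1"
  shows "\<exists>G'\<in>cross_sets (insert i S). \<forall>d\<in>G. \<forall>t. - h < t \<longrightarrow> t \<le> 1 / 2 \<longrightarrow>
    q + (1 + t / h) *\<^sub>R (d - q) + axis i t \<in> G'"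
proof -
  obtain f X T where f: "lattice_aut S f" and X: "gen_cross_polytope T X" and TS: "T \<subseteq> S"
    and GX: "G = f ` {x + w |x w. x \<in> X \<and> w \<in> coord_space (S - T)}"
    using G by (auto simp: cross_sets_def)
  have lin: "linear f" using f by (rule lattice_aut_linear)
  have XV: "X \<subseteq> coord_space S" using gen_cross_polytope_subset[OF X] coord_space_mono[OF TS] by blast
  have GV: "G \<subseteq> coord_space S"
    unfolding GX using XV coord_space_mono[of "S - T" S] lattice_aut_coord_space[OF f]
    by (auto intro: coord_space_add)
  obtain z0 where "0 - z0 \<in> G" using cross_sets_covering[OF G zero_in_coord_space] by blast
  define g0 where "g0 = 0 - z0"
  have g0: "g0 \<in> G" "g0 \<in> coord_space S" using \<open>0 - z0 \<in> G\<close> GV by (auto simp: g0_def)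
  \<comment> \<open>Arranged so that mixing \<open>g0\<close> and the translated point with weights
    \<open>1 - h\<close> and \<open>h\<close> gives \<open>q - h *\<^sub>R z\<close>.\<close>
  have "(1 / h) *\<^sub>R (q - (1 - h) *\<^sub>R g0) \<in> coord_space S" using q g0 by (intro coord_space_intros)
  then obtain z where z: "z \<in> int_lattice" "z \<in> coord_space S" "(1 / h) *\<^sub>R (q - (1 - h) *\<^sub>R g0) - z \<in> G"
    using cross_sets_covering[OF G] by blast
  define c where "c = q - h *\<^sub>R z"
  have "(1 - h) *\<^sub>R g0 + h *\<^sub>R ((1 / h) *\<^sub>R (q - (1 - h) *\<^sub>R g0) - z) \<in> G"
    using h by (intro convexD[OF cross_sets_convex[OF G] g0(1) z(3)]) auto
  then have "c \<in> G" using h by (simp add: c_def scaleR_diff_right)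
  then obtain c0 w0 where c0: "c0 \<in> X" "w0 \<in> coord_space (S - T)" "c = f (c0 + w0)" by (auto simp: GX)
  \<comment> \<open>With \<open>\<gamma> = 1 / 2\<close>, this value puts the lower end of the
    dilated unit interval at height \<open>- h\<close>.\<close>
  define \<mu> where "\<mu> = h / (h + 1 / 2)"
  have \<mu>: "0 < \<mu>" "\<mu> < 1" using h by (auto simp: \<mu>_def)
  define X' where "X' = convex hull
       ((\<lambda>x. ((1 / \<mu>) *\<^sub>R (x - c0) + c0) + axis i (1 / 2)) ` X \<union>
        (\<lambda>t. c0 + axis i ((1 / (1 - \<mu>)) * (t - 1 / 2) + 1 / 2)) ` {of_int \<lfloor>1 / 2 :: real\<rfloor> .. of_int \<lfloor>1 / 2 :: real\<rfloor> + 1})"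
  have "gen_cross_polytope (insert i T) X'"
    unfolding X'_def using X c0(1) \<mu> i TS by (intro gen_cross_polytope.step) auto
  moreover have "insert i T \<subseteq> insert i S" using TS by blast
  ultimately have std: "f ` {x + w |x w. x \<in> X' \<and> w \<in> coord_space (insert i S - insert i T)} \<in> cross_sets (insert i S)"
    unfolding cross_sets_def using lattice_aut_insert[OF f i] by blast
  have Seq: "insert i S - insert i T = S - T" using i by blast
  \<comment> \<open>The shear carries the apex \<open>c + axis i (- h)\<close> to
    \<open>q + axis i (- h)\<close>, because \<open>q = c + h *\<^sub>R z\<close>.\<close>
  define \<Phi> where "\<Phi> x = x + (x $ i) *\<^sub>R (- z)" for x
  have \<Phi>: "lattice_aut (insert i S) \<Phi>"
    unfolding \<Phi>_def using z i coord_space_mono[of S "insert i S"]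
    by (intro lattice_aut_shear) (auto intro: int_lattice_uminus coord_space_uminus simp: coord_space_nth)
  show ?thesis
  proof (intro bexI[OF _ cross_sets_aut[OF std \<Phi>]] ballI allI impI)
    fix d t assume d: "d \<in> G" and t: "- h < t" "t \<le> 1 / 2"
    define r where "r = 1 + t / h"
    obtain d0 w1 where d0: "d0 \<in> X" "w1 \<in> coord_space (S - T)" "d = f (d0 + w1)" using d by (auto simp: GX)
    define e where "e = (t + h) / (h + 1 / 2)"
    have e: "0 \<le> e" "e \<le> 1" using t h by (auto simp: e_def divide_le_eq)
    have "((1 / \<mu>) *\<^sub>R (d0 - c0) + c0) + axis i (1 / 2) \<in> X'"
      unfolding X'_def using d0(1) by (intro hull_inc UnI1 imageI)
    moreover have "c0 + axis i ((1 / (1 - \<mu>)) * (0 - 1 / 2) + 1 / 2) \<in> X'"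
      unfolding X'_def by (rule hull_inc, rule UnI2, rule imageI) simp
    ultimately have "e *\<^sub>R (((1 / \<mu>) *\<^sub>R (d0 - c0) + c0) + axis i (1 / 2)) +
        (1 - e) *\<^sub>R (c0 + axis i ((1 / (1 - \<mu>)) * (0 - 1 / 2) + 1 / 2)) \<in> X'"
      using e by (intro convexD) (auto simp: X'_def)
    also have "(1 / (1 - \<mu>)) * (0 - 1 / 2) + 1 / 2 = - h"
      using h by (simp add: \<mu>_def field_simps)
    also have "e *\<^sub>R (((1 / \<mu>) *\<^sub>R (d0 - c0) + c0) + axis i (1 / 2)) + (1 - e) *\<^sub>R (c0 + axis i (- h)) =
        c0 + r *\<^sub>R (d0 - c0) + axis i t"
    proof -
      have "h + 1 / 2 \<noteq> 0" using h by linarith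
      then have "e / \<mu> = (t + h) / h" by (simp only: e_def \<mu>_def divide_divide_times_eq) simp
      then have "e / \<mu> = r" using h by (simp add: r_def add_divide_distrib)
      moreover have "e * (h + 1 / 2) = t + h" unfolding e_def using \<open>h + 1 / 2 \<noteq> 0\<close> by simp
      then have "e * (1 / 2) + (1 - e) * (- h) = t" by (simp add: algebra_simps)
      ultimately show ?thesis
        by (simp add: vec_eq_iff axis_def algebra_simps flip: distrib_right)
    qed
    finally have "c0 + r *\<^sub>R (d0 - c0) + axis i t \<in> X'" .
    moreover have "w0 + r *\<^sub>R (w1 - w0) \<in> coord_space (insert i S - insert i T)"
      unfolding Seq using c0 d0 by (intro coord_space_intros)
    ultimately have "f ((c0 + r *\<^sub>R (d0 - c0) + axis i t) + (w0 + r *\<^sub>R (w1 - w0))) \<in>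
        f ` {x + w |x w. x \<in> X' \<and> w \<in> coord_space (insert i S - insert i T)}"
      by blast
    moreover have "f ((c0 + r *\<^sub>R (d0 - c0) + axis i t) + (w0 + r *\<^sub>R (w1 - w0))) = c + r *\<^sub>R (d - c) + axis i t"
      unfolding c0(3) d0(3) using lattice_aut_axis[OF f i, of t]
      by (simp add: linear_add[OF lin] linear_diff[OF lin] linear_cmul[OF lin] algebra_simps)
    ultimately have mem: "\<Phi> (c + r *\<^sub>R (d - c) + axis i t) \<in>
        \<Phi> ` f ` {x + w |x w. x \<in> X' \<and> w \<in> coord_space (insert i S - insert i T)}"
      by simp
    have "c $ i = 0" "d $ i = 0"
      using \<open>c \<in> G\<close> d GV i by (auto intro: coord_space_nth)
    then have "\<Phi> (c + r *\<^sub>R (d - c) + axis i t) = c + r *\<^sub>R (d - c) + axis i t - t *\<^sub>R z"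
      by (simp add: \<Phi>_def)
    also have "\<dots> = q + r *\<^sub>R (d - q) + axis i t + (h * r - h - t) *\<^sub>R z"
      by (simp add: c_def algebra_simps)
    also have "h * r - h - t = 0" using h by (simp add: r_def field_simps)
    finally have "\<Phi> (c + r *\<^sub>R (d - c) + axis i t) = q + (1 + t / h) *\<^sub>R (d - q) + axis i t"
      by (simp add: r_def)
    with mem show "q + (1 + t / h) *\<^sub>R (d - q) + axis i t \<in>
        \<Phi> ` f ` {x + w |x w. x \<in> X' \<and> w \<in> coord_space (insert i S - insert i T)}"
      by (simp only:)
  qed
qed

text \<open>The cone over the slice simplex with slopes \<open>a j = A j + 1\<close> has an apex \<open>q\<close> at height \<open>- h\<close>
  because the normals of a simplex take prescribed values up to one linear condition; truncating the
  cone gives the new simplex.\<close>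

lemma approximable_cone:
  fixes S :: "'n::finite set" and l :: "nat \<Rightarrow> real ^ 'n \<Rightarrow> real"
  assumes i: "i \<notin> S" and p: "p \<in> coord_space S"
    and G: "G \<in> cross_sets S" and fam: "simplex_family S k l w" and sub: "open_simplex S k l p \<subseteq> G"
    and \<beta>: "0 < \<beta>" "\<beta> \<le> 1" and F: "1 \<le> F" "\<And>x. x \<in> K \<Longrightarrow> \<bar>x $ i\<bar> \<le> F"
    and A: "\<And>x j. x \<in> K \<Longrightarrow> j < k \<Longrightarrow> l j (x - axis i (x $ i) - p) - A j * x $ i \<le> 1 / \<beta>"
    and A_nonneg: "0 \<le> (\<Sum>j<k. w j * A j)"
  shows "approximable (insert i S) p K (\<beta> / (4 * F))"
proof -
  have k: "0 < k" and lin: "\<And>j. j < k \<Longrightarrow> linear (l j)" and w: "\<And>j. j < k \<Longrightarrow> 0 < w j"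
    and dep: "\<And>x. x \<in> coord_space S \<Longrightarrow> (\<Sum>j<k. w j * l j x) = 0"
    and solve: "\<And>v. (\<Sum>j<k. w j * v j) = 0 \<Longrightarrow> \<exists>q\<in>coord_space S. \<forall>j<k. l j q = v j"
    using fam unfolding simplex_family_def by blast+
  have pi: "p $ i = 0" using p i by (rule coord_space_nth)
  \<comment> \<open>The extra 1 raises the weighted slope sum to at least \<open>L\<close>, so that
    the apex is at most 1 below the slice; it costs at most \<open>F\<close> in the bound on
    \<open>K\<close>.\<close>
  define a where "a j = A j + 1" for j
  define L where "L = (\<Sum>j<k. w j)"
  define s where "s = (\<Sum>j<k. w j * a j)"
  have L: "L > 0" unfolding L_def using k w by (intro sum_pos) auto
  have s: "s \<ge> L" using A_nonneg by (simp add: s_def a_def L_def algebra_simps sum.distrib)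
  define h where "h = L / s"
  have h: "0 < h" "h \<le> 1" using L s by (auto simp: h_def)
  \<comment> \<open>With \<open>h = L / s\<close> the values required of \<open>q\<close> obey the
    linear dependency, so all tilted facets meet in one point at height \<open>- h\<close>.\<close>
  have "(\<Sum>j<k. w j * (1 - a j * h)) = L - h * s"
    by (simp add: L_def s_def algebra_simps sum_subtractf sum_distrib_left)
  also have "\<dots> = 0" using L s by (simp add: h_def)
  finally obtain q where q: "q \<in> coord_space S" "\<And>j. j < k \<Longrightarrow> l j q = 1 - a j * h"
    using solve[of "\<lambda>j. 1 - a j * h"] by blast
  obtain G' where G': "G' \<in> cross_sets (insert i S)"
    and cone: "\<forall>d\<in>G. \<forall>t. - h < t \<longrightarrow> t \<le> 1 / 2 \<longrightarrow> p + q + (1 + t / h) *\<^sub>R (d - (p + q)) + axis i t \<in> G'"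
    using cross_sets_cone[OF G i coord_space_add[OF p q(1)] h] ..
  \<comment> \<open>The tilted facets together with a truncating facet at height
    \<open>1 / 2\<close>; the weight \<open>s / 2\<close> of the latter cancels the slopes in the
    dependency.\<close>
  define l' where "l' j x = (if j < k then l j (x - axis i (x $ i)) - a j * x $ i else 2 * x $ i)" for j x
  define w' where "w' j = (if j < k then w j else s / 2)" for j
  show ?thesis
  proof (rule approximableI[OF G'])
    show "simplex_family (insert i S) (Suc k) l' w'"
      unfolding simplex_family_def
    proof (intro conjI allI impI ballI)
      show "0 < Suc k" by simp
      show "linear (l' j)" if "j < Suc k" for j
      proof (cases "j < k")
        case True
        have axis_add: "axis i (u + v) = axis i u + axis i v" and axis_cmul: "axis i (r * u) = r *\<^sub>R axis i u"
          for u v r :: real by (simp_all add: vec_eq_iff axis_def)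
        show ?thesis
          unfolding l'_def using True
          by (intro linearI)
             (simp_all add: axis_add axis_cmul linear_add[OF lin[OF True]] linear_diff[OF lin[OF True]]
               linear_cmul[OF lin[OF True]] algebra_simps)
      next
        case False
        then show ?thesis unfolding l'_def by (intro linearI) (simp_all add: algebra_simps)
      qed
      show "0 < w' j" if "j < Suc k" for j using w L s by (simp add: w'_def)
    next
      fix x assume "x \<in> coord_space (insert i S)"
      then have y: "x - axis i (x $ i) \<in> coord_space S" by (rule coord_space_minus_axis)
      have "(\<Sum>j<Suc k. w' j * l' j x) =
          (\<Sum>j<k. w j * l j (x - axis i (x $ i)) - x $ i * (w j * a j)) + s * x $ i"
        by (simp add: w'_def l'_def algebra_simps)
      also have "\<dots> = 0"
        unfolding sum_subtractf dep[OF y] by (simp add: s_def flip: sum_distrib_left)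
      finally show "(\<Sum>j<Suc k. w' j * l' j x) = 0" .
    next
      fix v :: "nat \<Rightarrow> real" assume "(\<Sum>j<Suc k. w' j * v j) = 0"
      then have v: "(\<Sum>j<k. w j * v j) + s / 2 * v k = 0" by (simp add: w'_def)
      have "(\<Sum>j<k. w j * (v j + a j * (v k / 2))) = (\<Sum>j<k. w j * v j) + (\<Sum>j<k. w j * a j) * (v k / 2)"
        unfolding sum_distrib_right sum.distrib[symmetric] by (intro sum.cong refl) (simp add: algebra_simps)
      also have "\<dots> = 0" using v by (simp add: s_def)
      finally obtain u where u: "u \<in> coord_space S" "\<And>j. j < k \<Longrightarrow> l j u = v j + a j * (v k / 2)"
        using solve[of "\<lambda>j. v j + a j * (v k / 2)"] by blast
      have ui: "u $ i = 0" using u(1) i by (rule coord_space_nth)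
      have "l' j (u + axis i (v k / 2)) = v j" if "j < Suc k" for j
        using that u(2) ui by (auto simp: l'_def less_Suc_eq)
      moreover have "u + axis i (v k / 2) \<in> coord_space (insert i S)"
        using u(1) coord_space_mono[of S "insert i S"] by (auto intro!: coord_space_intros)
      ultimately show "\<exists>q\<in>coord_space (insert i S). \<forall>j<Suc k. l' j q = v j" by blast
    qed
    show "open_simplex (insert i S) (Suc k) l' p \<subseteq> G'"
    proof
      fix x assume "x \<in> open_simplex (insert i S) (Suc k) l' p"
      then have x: "x \<in> coord_space (insert i S)" and lt: "\<And>j. j < Suc k \<Longrightarrow> l' j (x - p) < 1"
        by (auto simp: open_simplex_def)
      define t where "t = x $ i"
      define y where "y = x - axis i t"
      have y: "y \<in> coord_space S" unfolding y_def t_def using x by (rule coord_space_minus_axis)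
      have yp: "x - p - axis i ((x - p) $ i) = y - p" by (simp add: y_def t_def pi)
      have t: "t \<le> 1 / 2" using lt[of k] pi by (simp add: l'_def t_def)
      have facet: "l j (y - p) - a j * t < 1" if "j < k" for j
        using lt[of j] that unfolding l'_def yp by (simp add: t_def pi)
      \<comment> \<open>Adding the facet inequalities with weights \<open>w\<close> eliminates
        \<open>y\<close> and leaves a lower bound on the height.\<close>
      have "0 < (\<Sum>j<k. w j * (1 + a j * t - l j (y - p)))"
        using k w facet by (intro sum_pos mult_pos_pos) (auto simp: algebra_simps)
      also have "\<dots> = L + s * t - (\<Sum>j<k. w j * l j (y - p))"
        unfolding L_def s_def sum_distrib_right sum.distrib[symmetric] sum_subtractf[symmetric]
        by (intro sum.cong refl) (simp add: algebra_simps)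
      also have "(\<Sum>j<k. w j * l j (y - p)) = 0" using y p by (intro dep coord_space_diff)
      finally have "- L < s * t" by simp
      then have th: "- h < t" using L s by (simp add: h_def field_simps)
      define r where "r = 1 + t / h"
      have r: "r > 0" using th h by (simp add: r_def field_simps)
      \<comment> \<open>The projection of \<open>x\<close> from the apex to the slice, which lands
        in the slice simplex.\<close>
      define d where "d = p + q + (1 / r) *\<^sub>R (y - (p + q))"
      have dV: "d \<in> coord_space S" unfolding d_def using p q(1) y by (intro coord_space_intros)
      have "l j (d - p) < 1" if j: "j < k" for j
      proof -
        have "l j (d - p) = l j q + (l j (y - p) - l j q) / r"
        proof -
          have "d - p = q + (1 / r) *\<^sub>R (y - p - q)" by (simp add: d_def diff_diff_eq)
          then show ?thesis
            by (simp only: linear_add[OF lin[OF j]] linear_diff[OF lin[OF j]] linear_cmul[OF lin[OF j]]) simp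
        qed
        also have "\<dots> < l j q + (1 + a j * t - l j q) / r"
          using facet[OF j] r by (intro add_strict_left_mono divide_strict_right_mono) auto
        also have "\<dots> = 1 - a j * h + a j * ((t + h) / r)"
          by (simp add: q(2)[OF j] algebra_simps add_divide_distrib)
        also have "r = (t + h) / h" using h by (simp add: r_def field_simps)
        also have "(t + h) / ((t + h) / h) = h" using th h by simp
        finally show ?thesis by simp
      qed
      then have "d \<in> G" using sub dV by (auto simp: open_simplex_def)
      then have "p + q + r *\<^sub>R (d - (p + q)) + axis i t \<in> G'" unfolding r_def using cone th t by blast
      moreover have "p + q + r *\<^sub>R (d - (p + q)) + axis i t = x" using r by (simp add: d_def y_def)
      ultimately show "x \<in> G'" by simp
    qed
    show "\<beta> / (4 * F) * l' j (x - p) < 1" if x: "x \<in> K" and j: "j < Suc k" for x j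
    proof (cases "j < k")
      case True
      have "l' j (x - p) = l j (x - axis i (x $ i) - p) - A j * x $ i - x $ i"
        using True pi by (simp add: l'_def a_def algebra_simps)
      also have "\<dots> \<le> 1 / \<beta> + F" using A[OF x True] F(2)[OF x] by linarith
      finally have "\<beta> / (4 * F) * l' j (x - p) \<le> \<beta> / (4 * F) * (1 / \<beta> + F)"
        using \<beta> F(1) by (intro mult_left_mono) auto
      also have "\<dots> = 1 / (4 * F) + \<beta> / 4" using \<beta> F(1) by (simp add: field_simps)
      also have "\<dots> < 1"
      proof -
        have "1 / (4 * F) \<le> 1 / 4" using F(1) by (simp add: field_simps)
        then show ?thesis using \<beta>(2) by linarith
      qed
      finally show ?thesis .
    next
      case False
      then have "l' j (x - p) = 2 * x $ i" using pi by (simp add: l'_def)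
      also have "\<dots> \<le> 2 * F" using F(2)[OF x] by linarith
      finally have "\<beta> / (4 * F) * l' j (x - p) \<le> \<beta> / (4 * F) * (2 * F)"
        using \<beta> F(1) by (intro mult_left_mono) auto
      also have "\<dots> < 1" using \<beta> F(1) by simp
      finally show ?thesis .
    qed
  qed
qed

text \<open>Each facet inequality of the slice simplex extends to \<open>K\<close> with some slope.
  \<open>approximable_cone\<close> wants a nonnegative weighted sum of slopes, which a reflection in
  the new coordinate achieves, if necessary, by changing the sign of all slopes.\<close>

lemma approximable_step:
  fixes S :: "'n::finite set"
  assumes i: "i \<notin> S" and p: "p \<in> coord_space S" and K: "convex K"
    and slice: "approximable S p {x \<in> K. x $ i = 0} \<beta>"
    and \<beta>: "0 < \<beta>" "\<beta> \<le> 1" and F: "1 \<le> F" "\<And>x. x \<in> K \<Longrightarrow> \<bar>x $ i\<bar> \<le> F"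
    and u: "u \<in> K" "u $ i > 0" and v: "v \<in> K" "v $ i < 0"
  shows "approximable (insert i S) p K (\<beta> / (4 * F))"
proof -
  obtain G k l w where G: "G \<in> cross_sets S" and fam: "simplex_family S k l w"
    and sub: "open_simplex S k l p \<subseteq> G"
    and bound: "\<And>x j. x \<in> {x \<in> K. x $ i = 0} \<Longrightarrow> j < k \<Longrightarrow> \<beta> * l j (x - p) < 1"
    using slice unfolding approximable_def by blast
  have pi: "p $ i = 0" using p i by (rule coord_space_nth)
  have "\<exists>b. \<forall>x\<in>K. l j (x - axis i (x $ i)) + b * x $ i \<le> 1 / \<beta> + l j p" if j: "j < k" for j
  proof (rule slice_functional_extension[OF K _ _ u v])
    have lin: "linear (l j)" using fam j by (simp add: simplex_family_def)
    have axis_add: "axis i (u + v) = axis i u + axis i v" and axis_cmul: "axis i (r * u) = r *\<^sub>R axis i u"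
      for u v r :: real by (simp_all add: vec_eq_iff axis_def)
    show "linear (\<lambda>x. l j (x - axis i (x $ i)))"
      by (intro linearI)
         (simp_all add: axis_add axis_cmul linear_add[OF lin] linear_diff[OF lin] linear_cmul[OF lin] algebra_simps)
    fix x assume x: "x \<in> K" "x $ i = 0"
    have "\<beta> * l j (x - p) < 1" using bound x j by simp
    then have "l j x - l j p < 1 / \<beta>" using \<beta> by (simp add: linear_diff[OF lin] field_simps)
    moreover have eq: "x - axis i (x $ i) = x" using x by (simp add: vec_eq_iff axis_def)
    ultimately show "l j (x - axis i (x $ i)) \<le> 1 / \<beta> + l j p" unfolding eq by simp
  qed
  then obtain b where b: "\<And>j x. j < k \<Longrightarrow> x \<in> K \<Longrightarrow> l j (x - axis i (x $ i)) + b j * x $ i \<le> 1 / \<beta> + l j p"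
    by metis
  have A: "l j (x - axis i (x $ i) - p) - (- b j) * x $ i \<le> 1 / \<beta>" if "x \<in> K" "j < k" for x j
  proof -
    have "linear (l j)" using fam that by (simp add: simplex_family_def)
    then show ?thesis using b[OF that(2,1)] linear_diff[of "l j" "x - axis i (x $ i)" p] by simp
  qed
  show ?thesis
  proof (cases "0 \<le> (\<Sum>j<k. w j * (- b j))")
    case True
    show ?thesis by (rule approximable_cone[OF i p G fam sub \<beta> F A True])
  next
    case False
    define \<rho> where "\<rho> x = x - axis i (2 * x $ i)" for x :: "real ^ 'n"
    have aut: "lattice_aut (insert i S) \<rho>" unfolding \<rho>_def by (rule lattice_aut_reflect) simp
    have \<rho>i: "\<rho> x $ i = - x $ i" for x by (simp add: \<rho>_def)
    have \<rho>\<rho>: "\<rho> (\<rho> x) = x" for x by (simp add: \<rho>_def vec_eq_iff axis_def)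
    have \<rho>S: "\<rho> x - axis i (\<rho> x $ i) = x - axis i (x $ i)" for x by (simp add: \<rho>_def vec_eq_iff axis_def)
    have "approximable (insert i S) p (\<rho> ` K) (\<beta> / (4 * F))"
    proof (rule approximable_cone[OF i p G fam sub \<beta> F(1)])
      show "\<bar>x $ i\<bar> \<le> F" if "x \<in> \<rho> ` K" for x using that F(2) by (auto simp: \<rho>i)
      show "l j (x - axis i (x $ i) - p) - b j * x $ i \<le> 1 / \<beta>" if "x \<in> \<rho> ` K" "j < k" for x j
      proof -
        obtain y where y: "y \<in> K" "x = \<rho> y" using \<open>x \<in> \<rho> ` K\<close> by blast
        show ?thesis using A[OF y(1) \<open>j < k\<close>] unfolding y(2) \<rho>S by (simp add: \<rho>i)
      qed
      show "0 \<le> (\<Sum>j<k. w j * b j)" using False by (simp add: sum_negf)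
    qed
    from approximable_aut[OF this aut] have "approximable (insert i S) (\<rho> p) (\<rho> ` \<rho> ` K) (\<beta> / (4 * F))" .
    moreover have "\<rho> p = p" using pi by (simp add: \<rho>_def vec_eq_iff axis_def)
    moreover have "\<rho> ` \<rho> ` K = K" by (simp add: image_image \<rho>\<rho>)
    ultimately show ?thesis by simp
  qed
qed

text \<open>Fixes a denominator \<open>s\<close> and not the point: the changes of coordinates and
  integer translations in the induction alter \<open>p\<close> but keep
  \<open>real s *\<^sub>R p\<close> integral. The radius of the ball must not influence
  \<open>\<alpha>\<close>.\<close>

definition uniformly_approximable :: "'n::finite set \<Rightarrow> nat \<Rightarrow> real \<Rightarrow> bool" where
  "uniformly_approximable S s \<alpha> \<longleftrightarrow> (\<forall>p K. p \<in> coord_space S \<longrightarrow> real s *\<^sub>R p \<in> int_lattice \<longrightarrow>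
     p \<notin> int_lattice \<longrightarrow> K \<subseteq> coord_space S \<longrightarrow> closed K \<longrightarrow> convex K \<longrightarrow> K \<inter> int_lattice = {} \<longrightarrow>
     (\<exists>r>0. \<forall>x\<in>coord_space S. norm (x - p) < r \<longrightarrow> x \<in> K) \<longrightarrow> approximable S p K \<alpha>)"

lemma uniformly_approximableD:
  assumes "uniformly_approximable S s \<alpha>" "p \<in> coord_space S" "real s *\<^sub>R p \<in> int_lattice"
    "p \<notin> int_lattice" "K \<subseteq> coord_space S" "closed K" "convex K" "K \<inter> int_lattice = {}"
    "0 < r" "\<And>x. x \<in> coord_space S \<Longrightarrow> norm (x - p) < r \<Longrightarrow> x \<in> K"
  shows "approximable S p K \<alpha>"
  using assms unfolding uniformly_approximable_def by blast

text \<open>A nonintegral \<open>p $ i\<close> leads to a split, an integral one to the slice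
  through \<open>p\<close> and the smaller coordinate set; the constant is below those of both
  branches as \<open>\<beta> \<le> 1\<close> and \<open>s\<close> is at least 1.\<close>

lemma approximable_of_flat_coordinate:
  fixes S :: "'n::finite set"
  assumes i: "i \<notin> S" and s: "0 < s" and IH: "uniformly_approximable S s \<beta>" and \<beta>: "0 < \<beta>" "\<beta> \<le> 1"
    and F: "1 \<le> F" "\<And>x. x \<in> K \<Longrightarrow> \<bar>x $ i - p $ i\<bar> \<le> F"
    and p: "p \<in> coord_space (insert i S)" "real s *\<^sub>R p \<in> int_lattice" "p \<notin> int_lattice"
    and K: "K \<subseteq> coord_space (insert i S)" "closed K" "convex K" "K \<inter> int_lattice = {}"
    and r: "0 < r" and ball: "\<And>x. x \<in> coord_space (insert i S) \<Longrightarrow> norm (x - p) < r \<Longrightarrow> x \<in> K"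
  shows "approximable (insert i S) p K (\<beta> / (4 * real s * F))"
proof (cases "p $ i \<in> \<int>")
  case False
  have "real s * p $ i \<in> \<int>" using p(2) by (simp add: int_lattice_def)
  then have "approximable (insert i S) p K (1 / (2 * real s * F))"
    using False s F by (intro approximable_split) auto
  then show ?thesis
    using \<beta> s F(1) by (rule_tac approximable_mono) (auto simp: field_simps)
next
  case True
  define \<tau> where "\<tau> = axis i (p $ i)"
  have \<tau>: "\<tau> \<in> int_lattice" "\<tau> \<in> coord_space (insert i S)"
    unfolding \<tau>_def using True by (auto intro: axis_in_int_lattice axis_in_coord_space)
  define p' where "p' = p - \<tau>"
  define K' where "K' = (+) (- \<tau>) ` K"
  have K'_iff: "x \<in> K' \<longleftrightarrow> \<tau> + x \<in> K" for x
    unfolding K'_def by (auto intro!: image_eqI[of _ _ "\<tau> + x"])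
  have p'S: "p' \<in> coord_space S" unfolding p'_def \<tau>_def using p(1) by (rule coord_space_minus_axis)
  have p'i: "p' $ i = 0" using p'S i by (rule coord_space_nth)
  have ball': "x \<in> K'" if "x \<in> coord_space (insert i S)" "norm (x - p') < r" for x
    unfolding K'_iff
    using ball[of "\<tau> + x"] that \<tau>(2) by (auto simp: p'_def algebra_simps intro: coord_space_add)
  have slice: "approximable S p' {x \<in> K'. x $ i = 0} \<beta>"
  proof (rule uniformly_approximableD[OF IH p'S _ _ _ _ _ _ r])
    show "real s *\<^sub>R p' \<in> int_lattice"
      unfolding p'_def scaleR_diff_right
      by (rule int_lattice_diff[OF p(2) int_lattice_scale[OF Ints_of_nat \<tau>(1)]])
    show "p' \<notin> int_lattice"
      using p(3) int_lattice_add[OF _ \<tau>(1), of p'] by (auto simp: p'_def)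
    show "{x \<in> K'. x $ i = 0} \<subseteq> coord_space S"
    proof clarify
      fix x assume "x \<in> K'" "x $ i = 0"
      then have "\<tau> + x - \<tau> \<in> coord_space (insert i S)"
        using K(1) \<tau>(2) by (intro coord_space_diff) (auto simp: K'_iff)
      then show "x \<in> coord_space S" using \<open>x $ i = 0\<close> by (auto simp: coord_space_def)
    qed
    have "closed K'" unfolding K'_def using K(2) by (rule closed_translation)
    moreover have "closed {x :: real ^ 'n. x $ i = 0}" by (intro closed_Collect_eq continuous_intros)
    ultimately have "closed (K' \<inter> {x. x $ i = 0})" by (rule closed_Int)
    then show "closed {x \<in> K'. x $ i = 0}" by (simp add: Collect_conj_eq)
    have "convex K'" unfolding K'_def using K(3) by (rule convex_translation)
    moreover have "convex {x :: real ^ 'n. x $ i = 0}" by (auto simp: convex_def)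
    ultimately have "convex (K' \<inter> {x. x $ i = 0})" by (rule convex_Int)
    then show "convex {x \<in> K'. x $ i = 0}" by (simp add: Collect_conj_eq)
    show "{x \<in> K'. x $ i = 0} \<inter> int_lattice = {}"
      using K(4) int_lattice_add[OF \<tau>(1)] by (auto simp: K'_iff)
    show "x \<in> {x \<in> K'. x $ i = 0}" if "x \<in> coord_space S" "norm (x - p') < r" for x
      using that ball'[of x] coord_space_mono[of S "insert i S"] coord_space_nth[OF that(1) i] by auto
  qed
  have "approximable (insert i S) p' K' (\<beta> / (4 * F))"
  proof (rule approximable_step[OF i p'S _ slice \<beta> F(1)])
    show "convex K'" unfolding K'_def using K(3) by (rule convex_translation)
    show "\<bar>x $ i\<bar> \<le> F" if "x \<in> K'" for x
      using F(2)[of "\<tau> + x"] that by (simp add: K'_iff \<tau>_def)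
    have p'V: "p' \<in> coord_space (insert i S)" using p'S coord_space_mono[of S "insert i S"] by blast
    \<comment> \<open>The ball around \<open>p'\<close> supplies points on both sides of the slice,
      as the extension of slopes requires.\<close>
    have "norm (axis i (r / 2)) < r" "norm (axis i (- (r / 2))) < r"
      using r by (simp_all add: axis_eq_scaleR[of i "r / 2"] axis_eq_scaleR[of i "- (r / 2)"])
    then show "p' + axis i (r / 2) \<in> K'" "p' + axis i (- (r / 2)) \<in> K'"
      using p'V by (auto intro!: ball' coord_space_intros)
    show "0 < (p' + axis i (r / 2)) $ i" "(p' + axis i (- (r / 2))) $ i < 0" using p'i r by simp_all
  qed
  from approximable_translate[OF this \<tau>] have "approximable (insert i S) p K (\<beta> / (4 * F))"
    by (simp add: p'_def K'_def image_image)
  then show ?thesis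
    using \<beta> s F(1) by (rule_tac approximable_mono) (auto simp: field_simps)
qed

lemma lattice_free_approximable:
  fixes S :: "'n::finite set"
  assumes s: "0 < s"
  shows "\<exists>\<alpha>>0. \<alpha> \<le> 1 \<and> uniformly_approximable S s \<alpha>"
  using finite[of S]
proof (induction S rule: finite_induct)
  case empty
  \<comment> \<open>In dimension zero the only point is 0, a lattice point, so there is no
    admissible \<open>p\<close>.\<close>
  show ?case
    by (intro exI[of _ 1]) (auto simp: uniformly_approximable_def coord_space_empty zero_in_int_lattice)
next
  case (insert i S)
  let ?V = "coord_space (insert i S)"
  obtain \<beta> where \<beta>: "0 < \<beta>" "\<beta> \<le> 1" and IH: "uniformly_approximable S s \<beta>" using insert.IH by blast
  obtain F where F: "F \<ge> 1" and flat: "\<And>K. K \<subseteq> ?V \<Longrightarrow> closed K \<Longrightarrow> convex K \<Longrightarrow> K \<inter> int_lattice = {} \<Longrightarrow>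
      (\<exists>p\<in>?V. \<exists>r>0. \<forall>x\<in>?V. norm (x - p) < r \<longrightarrow> x \<in> K) \<Longrightarrow>
      \<exists>\<phi>. int_functional (insert i S) \<phi> \<and> (\<forall>x\<in>K. \<forall>y\<in>K. \<phi> x - \<phi> y \<le> F)"
    using flatness[of "insert i S"] by metis
  have "approximable (insert i S) p K (\<beta> / (4 * real s * F))"
    if p: "p \<in> ?V" "real s *\<^sub>R p \<in> int_lattice" "p \<notin> int_lattice"
      and K: "K \<subseteq> ?V" "closed K" "convex K" "K \<inter> int_lattice = {}"
      and r: "0 < r" and ball: "\<And>x. x \<in> ?V \<Longrightarrow> norm (x - p) < r \<Longrightarrow> x \<in> K" for p K r
  proof -
    have "\<exists>\<phi>. int_functional (insert i S) \<phi> \<and> (\<forall>x\<in>K. \<forall>y\<in>K. \<phi> x - \<phi> y \<le> F)"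
      using p(1) r ball by (intro flat[OF K]) blast
    then obtain \<phi> where \<phi>: "int_functional (insert i S) \<phi>" "\<And>x y. x \<in> K \<Longrightarrow> y \<in> K \<Longrightarrow> \<phi> x - \<phi> y \<le> F"
      by blast
    obtain f g where f: "lattice_aut (insert i S) f" and g: "g \<in> \<int>" "\<And>x. x \<in> ?V \<Longrightarrow> \<phi> (f x) = g * x $ i"
      using int_functional_normal_form[of i "insert i S" \<phi>] \<phi>(1) by (auto simp: int_functional_def)
    have inv: "lattice_aut (insert i S) (inv f)" using f by (rule lattice_aut_inv)
    have lin: "linear f" "linear (inv f)" using f inv by (auto intro: lattice_aut_linear)
    note cancel = lattice_aut_inv_cancel[OF f]
    obtain x0 where "x0 \<in> ?V" "\<phi> (f x0) \<noteq> 0"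
      using int_functional_comp[OF f \<phi>(1)] by (auto simp: int_functional_def)
    then have g1: "\<bar>g\<bar> \<ge> 1" using g by (auto elim!: Ints_cases)
    define p' where "p' = inv f p"
    define K' where "K' = inv f ` K"
    have K'_iff: "x \<in> K' \<longleftrightarrow> f x \<in> K" for x
      unfolding K'_def by (auto simp: cancel intro!: image_eqI[of _ _ "f x"])
    have pK: "p \<in> K" using ball[OF p(1)] r by simp
    have p'V: "p' \<in> ?V" unfolding p'_def using inv p(1) by (rule lattice_aut_coord_space)
    \<comment> \<open>Serves to replace the radius by \<open>r / B\<close> in the new coordinates;
      the constant does not depend on the radius.\<close>
    obtain B where B: "B > 0" "\<And>x. norm (f x) \<le> B * norm x" using linear_bounded_pos[OF lin(1)] by blast
    have "approximable (insert i S) p' K' (\<beta> / (4 * real s * F))"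
    proof (rule approximable_of_flat_coordinate[OF \<open>i \<notin> S\<close> s IH \<beta> F _ p'V])
      show K'V: "K' \<subseteq> ?V" unfolding K'_def using K(1) by (auto intro!: lattice_aut_coord_space[OF inv])
      show "\<bar>x $ i - p' $ i\<bar> \<le> F" if x: "x \<in> K'" for x
      proof -
        have "f x \<in> K" "x \<in> ?V" using x K'V by (auto simp: K'_iff)
        then have "\<bar>\<phi> (f x) - \<phi> p\<bar> \<le> F" using \<phi>(2)[of "f x" p] \<phi>(2)[of p "f x"] pK by (simp add: abs_le_iff)
        moreover have "\<phi> p = g * p' $ i" using g(2)[OF p'V] by (simp add: p'_def cancel)
        ultimately have "\<bar>g\<bar> * \<bar>x $ i - p' $ i\<bar> \<le> F"
          using g(2)[OF \<open>x \<in> ?V\<close>] by (simp flip: abs_mult right_diff_distrib)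
        moreover have "1 * \<bar>x $ i - p' $ i\<bar> \<le> \<bar>g\<bar> * \<bar>x $ i - p' $ i\<bar>" using g1 by (intro mult_right_mono) auto
        ultimately show ?thesis by simp
      qed
      show "real s *\<^sub>R p' \<in> int_lattice"
        using lattice_aut_int_lattice[OF inv p(2)] by (simp add: p'_def linear_cmul[OF lin(2)])
      show "p' \<notin> int_lattice"
        using lattice_aut_int_lattice[OF f, of p'] p(3) by (auto simp: p'_def cancel)
      have vim: "K' = f -` K" by (auto simp: K'_iff)
      show "closed K'"
        unfolding vim using K(2) lin(1)
        by (intro continuous_closed_vimage linear_continuous_at) (auto simp: linear_conv_bounded_linear)
      show "convex K'" unfolding K'_def using lin(2) K(3) by (rule convex_linear_image)
      show "K' \<inter> int_lattice = {}"
        using K(4) lattice_aut_int_lattice[OF f] by (auto simp: K'_iff)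
      show "0 < r / B" using r B by simp
      show "x \<in> K'" if x: "x \<in> ?V" "norm (x - p') < r / B" for x
        unfolding K'_iff
      proof (rule ball)
        show "f x \<in> ?V" using f x(1) by (rule lattice_aut_coord_space)
        have "f x - p = f (x - p')" by (simp add: linear_diff[OF lin(1)] p'_def cancel)
        then have "norm (f x - p) \<le> B * norm (x - p')" using B(2) by simp
        also have "\<dots> < r" using x(2) B(1) by (simp add: field_simps)
        finally show "norm (f x - p) < r" .
      qed
    qed
    from approximable_aut[OF this f] show ?thesis
      by (simp add: p'_def K'_def image_image cancel)
  qed
  then have "uniformly_approximable (insert i S) s (\<beta> / (4 * real s * F))"
    unfolding uniformly_approximable_def by blast
  moreover have "0 < \<beta> / (4 * real s * F)" using \<beta> s F by simp
  moreover have "\<beta> / (4 * real s * F) \<le> 1"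
  proof -
    have "1 * 1 \<le> real s * F" using s F by (intro mult_mono) auto
    then show ?thesis using \<beta> s F by (simp add: divide_le_eq mult.assoc)
  qed
  ultimately show ?case by blast
qed

section \<open>The second inclusion for rational \<open>b\<close>\<close>

lemma lattice_free_approximation:
  fixes b :: "real ^ 'n"
  assumes rat: "\<forall>i. b $ i \<in> \<rat>" and b: "b \<notin> int_lattice"
  shows "\<exists>\<alpha>>0. \<alpha> \<le> 1 \<and> (\<forall>B. lattice_free b B \<longrightarrow> (\<exists>C\<in>cross_family b. \<forall>x\<in>B. \<alpha> *\<^sub>R x \<in> C))"
proof -
  have "\<exists>m>0. real m * b $ i \<in> \<int>" for i
  proof -
    obtain c d :: int where cd: "d > 0" "b $ i = of_int c / of_int d"
      using rat by (metis Rats_cases')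
    then have "real (nat d) * b $ i = of_int c" by simp
    then show ?thesis using cd(1) by (intro exI[of _ "nat d"]) auto
  qed
  then obtain m where m: "\<And>i. m i > 0" "\<And>i. real (m i) * b $ i \<in> \<int>" by metis
  \<comment> \<open>A common denominator of the entries of \<open>b\<close>, through which the
    constant depends on \<open>b\<close>.\<close>
  define s where "s = prod m UNIV"
  have s: "s > 0" unfolding s_def using m(1) by (simp add: prod_pos)
  have "real s * b $ i \<in> \<int>" for i
  proof -
    have eq: "real s * b $ i = real (prod m (UNIV - {i})) * (real (m i) * b $ i)"
      unfolding s_def by (subst prod.remove[of UNIV i]) auto
    show ?thesis unfolding eq by (rule Ints_mult[OF Ints_of_nat m(2)])
  qed
  then have sb: "real s *\<^sub>R (- b) \<in> int_lattice" by (simp add: int_lattice_def)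
  have nb: "- b \<notin> int_lattice" using b int_lattice_uminus[of "- b"] by auto
  obtain \<alpha> where \<alpha>: "0 < \<alpha>" "\<alpha> \<le> 1" and ua: "uniformly_approximable (UNIV :: 'n set) s \<alpha>"
    using lattice_free_approximable[OF s] by blast
  have "\<exists>C\<in>cross_family b. \<forall>x\<in>B. (\<alpha> / 2) *\<^sub>R x \<in> C" if B: "lattice_free b B" for B
  proof -
    have cB: "closed B" "convex B" "0 \<in> interior B" "interior B \<inter> (+) b ` int_lattice = {}"
      using B by (auto simp: lattice_free_def)
    \<comment> \<open>The halved set lies in the interior of \<open>B\<close>, so all of
      \<open>K\<close>, and not merely its interior, misses the lattice.\<close>
    define K where "K = (\<lambda>x. - b + x) ` (\<lambda>x. (1 / 2) *\<^sub>R x) ` B"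
    obtain e where e: "e > 0" "ball 0 e \<subseteq> B" using cB(3) mem_interior by blast
    have K_iff: "y \<in> K \<longleftrightarrow> 2 *\<^sub>R (b + y) \<in> B" for y
    proof
      assume "2 *\<^sub>R (b + y) \<in> B"
      then show "y \<in> K" unfolding K_def image_image by (intro image_eqI[of _ _ "2 *\<^sub>R (b + y)"]) auto
    qed (auto simp: K_def)
    have "approximable UNIV (- b) K \<alpha>"
    proof (rule uniformly_approximableD[OF ua _ sb nb])
      show "- b \<in> coord_space UNIV" "K \<subseteq> coord_space UNIV" by (simp_all add: coord_space_UNIV)
      show "closed K" unfolding K_def using cB(1) by (intro closed_translation closed_scaling)
      show "convex K" unfolding K_def using cB(2) by (intro convex_translation convex_scaling)
      show "K \<inter> int_lattice = {}"
      proof (rule ccontr)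
        assume "K \<inter> int_lattice \<noteq> {}"
        then obtain z where z: "z \<in> int_lattice" "2 *\<^sub>R (b + z) \<in> B" by (auto simp: K_iff)
        have "2 *\<^sub>R (b + z) - (1 / 2) *\<^sub>R (2 *\<^sub>R (b + z) - 0) \<in> interior B"
          using cB z(2) by (intro mem_interior_convex_shrink) auto
        moreover have "2 *\<^sub>R (b + z) - (1 / 2) *\<^sub>R (2 *\<^sub>R (b + z) - 0) = b + z"
          by (simp add: vec_eq_iff)
        ultimately show False using cB(4) z(1) by auto
      qed
      show "0 < e / 2" using e by simp
      show "x \<in> K" if "norm (x - - b) < e / 2" for x
        unfolding K_iff using that e(2) by (intro subsetD[OF e(2)]) (simp add: add.commute)
    qed
    then obtain G k l w where G: "G \<in> cross_sets UNIV" and fam: "simplex_family UNIV k l w"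
      and sub: "open_simplex UNIV k l (- b) \<subseteq> G"
      and lK: "\<And>x j. x \<in> K \<Longrightarrow> j < k \<Longrightarrow> \<alpha> * l j (x - (- b)) < 1"
      unfolding approximable_def by blast
    have in_G: "- b + (\<alpha> / 2) *\<^sub>R x \<in> G" if x: "x \<in> B" for x
    proof -
      have "l j ((\<alpha> / 2) *\<^sub>R x) < 1" if j: "j < k" for j
      proof -
        have lin: "linear (l j)" using fam j by (simp add: simplex_family_def)
        have "- b + (1 / 2) *\<^sub>R x \<in> K" using x by (auto simp: K_def)
        from lK[OF this j] show ?thesis by (simp add: linear_cmul[OF lin])
      qed
      then have "- b + (\<alpha> / 2) *\<^sub>R x \<in> open_simplex UNIV k l (- b)"
        by (simp add: open_simplex_def coord_space_UNIV)
      then show ?thesis using sub by blast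
    qed
    have "interior ((\<lambda>x. - b + x) ` (\<lambda>x. (\<alpha> / 2) *\<^sub>R x) ` B) \<subseteq> interior G"
      using in_G by (intro interior_mono) auto
    moreover have "- b \<in> interior ((\<lambda>x. - b + x) ` (\<lambda>x. (\<alpha> / 2) *\<^sub>R x) ` B)"
    proof -
      have "interior ((\<lambda>x. (\<alpha> / 2) *\<^sub>R x) ` B) = (\<lambda>x. (\<alpha> / 2) *\<^sub>R x) ` interior B"
        using \<alpha>(1) by (intro interior_injective_linear_image linear_scaleR) (auto simp: inj_on_def)
      then show ?thesis
        unfolding interior_translation using cB(3) by (force simp: image_iff)
    qed
    ultimately have "(+) b ` G \<in> cross_family b"
      unfolding cross_family_def using cross_sets_UNIV[OF G] by blast
    moreover have "(\<alpha> / 2) *\<^sub>R x \<in> (+) b ` G" if "x \<in> B" for x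
      using in_G[OF that] by (intro image_eqI[of _ _ "- b + (\<alpha> / 2) *\<^sub>R x"]) auto
    ultimately show ?thesis by blast
  qed
  then show ?thesis using \<alpha> by (intro exI[of _ "\<alpha> / 2"]) auto
qed

theorem theorem1p6:
  fixes b :: "real ^ 'n"
  assumes "\<forall>i. b $ i \<in> \<rat>"
    and "b \<notin> int_lattice"
  shows "\<exists>\<alpha>>0. \<forall>(R :: (real ^ 'n) list) (P :: (real ^ 'n) list).
           M_closure b R P \<subseteq> G_closure b R P \<and>
           G_closure b R P \<subseteq> scale_set \<alpha> (M_closure b R P)"
proof -
  obtain \<alpha> where \<alpha>: "0 < \<alpha>" "\<alpha> \<le> 1"
    and approx: "\<And>B. lattice_free b B \<Longrightarrow> \<exists>C\<in>cross_family b. \<forall>x\<in>B. \<alpha> *\<^sub>R x \<in> C"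
    using lattice_free_approximation[OF assms] by blast
  have "G_closure b R P \<subseteq> scale_set \<alpha> (M_closure b R P)" for R P :: "(real ^ 'n) list"
  proof clarify
    fix s y assume sy: "(s, y) \<in> G_closure b R P"
    let ?s = "map ((*) (1 / \<alpha>)) s" and ?y = "map ((*) (1 / \<alpha>)) y"
    have "(?s, ?y) \<in> H B R P" if "maximal_lattice_free b B" for B
    proof -
      have B: "lattice_free b B" using that by (simp add: maximal_lattice_free_def)
      then obtain C where C: "C \<in> cross_family b" "\<And>x. x \<in> B \<Longrightarrow> \<alpha> *\<^sub>R x \<in> C" using approx by blast
      have "(s, y) \<in> H C R P" using sy C(1) by (auto simp: G_closure_def)
      moreover have "0 \<in> interior B" "0 \<in> interior C"
        using B cross_family_lattice_free[OF C(1)] by (auto simp: lattice_free_def)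
      ultimately show ?thesis using \<alpha> C(2) by (intro H_scaled_subset) auto
    qed
    then have "(?s, ?y) \<in> M_closure b R P" by (auto simp: M_closure_def)
    moreover have "(s, y) = (\<lambda>(s, y). (map ((*) \<alpha>) s, map ((*) \<alpha>) y)) (?s, ?y)"
      using \<alpha>(1) by (simp add: o_def map_idI)
    ultimately show "(s, y) \<in> scale_set \<alpha> (M_closure b R P)"
      unfolding scale_set_def by (rule image_eqI[rotated])
  qed
  then show ?thesis using \<alpha>(1) M_closure_subset_G_closure by blast
qed

end
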